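(* Let $(X,\|\cdot\|)$ and $(V,\|\cdot\|_V)$ be real Banach spaces, $S\subseteq X$, with a symmetrization map $*$ and a polarization map indexed by $\mathcal H_*$ forming an abstract symmetrization framework (defined in the context). Let $m\ge 1$, let $\mathbb D$ and $\mathbb S$ be the closed unit ball and the unit sphere of $\mathbb R^m$. Let $\Lambda\subset\mathbb R$ be a compact interval, and let $f:\Lambda\times X\to\mathbb R$ be such that $f(\lambda;\cdot)$ is continuous for every $\lambda\in\Lambda$. Let $\Gamma_0\subset C(\mathbb S;X)$ and $$\Gamma:=\{\gamma\in C(\mathbb D,X):\gamma|_{\mathbb S}\in\Gamma_0\}\neq\emptyset,\quad c(\lambda):=\inf_{\gamma\in\Gamma}\sup_{t\in\mathbb D}f(\lambda;\gamma(t)),\quad a(\lambda):=\sup_{\gamma_0\in\Gamma_0}\sup_{\tau\in\mathbb S}f(\lambda;\gamma_0(\tau)).$$ Assume: (i) $c(\lambda)>a(\lambda)$ for all $\lambda\in\Lambda$. (ii) For every sequence $(\lambda_h,u_h)\subset\Lambda\times X$ with $(\lambda_h)$ strictly increasing and converging to $\lambda$, for which there exists $C\in\mathbb R$ with $$f(\lambda_h;u_h)\le C,\qquad -f(\lambda;u_h)\le C,\qquad \frac{f(\lambda_h;u_h)-f(\lambda;u_h)}{\lambda-\lambda_h}\le C\qquad\text{for all }h\ge1,$$ one has $\|u_h\|\le\mathcal M$ for some number $\mathcal M=\mathcal M(C)\ge0$ and all $h\ge1$, and, for every $\varepsilon>0$, $f(\lambda;u_h)\le f(\lambda_h;u_h)+\varepsilon$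 for all $h\ge1$ sufficiently large. (iii) For every $\gamma\in\Gamma$ there are $\hat\gamma\in\Gamma$ and $H_0\in\mathcal H_*$ such that $\hat\gamma(\mathbb D)\subset S$, the map $\tau\mapsto\hat\gamma(\tau)^{H_0}$ on $\mathbb S$ belongs to $\Gamma_0$, and $f(\lambda;\hat\gamma(t))\le f(\lambda;\gamma(t))$ for all $t\in\mathbb D$ and $\lambda\in\Lambda$. Moreover, $f(\lambda;u^H)\le f(\lambda;u)$ for all $\lambda\in\Lambda$, $H\in\mathcal H_*$ and $u\in S$. Then for almost every $\lambda\in\Lambda$ (with respect to Lebesgue measure) the functional $f(\lambda;\cdot)$ possesses a $(SBPS)_{c(\lambda)}$-sequence.
   Context: Abstract symmetrization framework: $X,V$ are Banach spaces, $S\subseteq X$, $\mathcal H_*$ is a path-connected topological space, and two maps are given: $*:S\to S$, $u\mapsto u^*$ (symmetrization), and $h:S\times\mathcal H_*\to S$, $(u,H)\mapsto u^H$ (polarization), such that: (1) $X$ is continuously embedded in $V$; (2) $h$ is continuous ($S$ with the topology induced by $X$); (3) for all $u\in S$, $H\in\mathcal H_*$: $(u^* )^H=(u^H)^*=u^*$ and $u^{HH}=u^H$; (4) there is a sequence $(H_m)\subset\mathcal H_*$ such that, for every $u\in S$, $u^{H_1\cdots H_m}:=(\cdots(u^{H_1})^{H_2}\cdots)^{H_m}$ converges to $u^*$ in $V$ as $m\to\infty$; (5) $\|u^H-v^H\|_V\le\|u-v\|_V$ for all $u,v\in S$, $H\in\mathcal H_*$. Moreover there is given a Lipschitz map $\Theta:(X,\|\cdot\|_V)\to(S,\|\cdot\|_V)$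 with $\Theta|_S=\mathrm{Id}|_S$, and $*$ is extended to all of $X$ by $u^*:=(\Theta(u))^*$ for $u\in X$. (Consequently there is $C_\Theta>0$ with $\|u^*-v^*\|_V\le C_\Theta\|u-v\|_V$ for all $u,v\in X$.) Weak slope: for a metric space $(X,d)$, a continuous $g:X\to\mathbb R$ and $u\in X$, $|dg|(u)\in[0,+\infty]$ is the supremum of the $\sigma\in[0,\infty)$ such that there exist $\delta>0$ and a continuous map $\mathcal H:B(u,\delta)\times[0,\delta]\to X$ ($B(u,\delta)$ the open ball) with $d(\mathcal H(v,t),v)\le t$ and $g(\mathcal H(v,t))\le g(v)-\sigma t$ for all $v\in B(u,\delta)$, $t\in[0,\delta]$. $(SBPS)_c$-sequence (symmetric bounded Palais-Smale sequence at level $c\in\mathbb R$) for a continuous $g:X\to\mathbb R$: a sequence $(u_n)\subset X$ that is bounded in $X$ and satisfies $|dg|(u_n)\to0$, $g(u_n)\to c$ and $\|u_n-u_n^*\|_V\to0$. *)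

theory Defs
  imports "HOL-Analysis.Analysis"
begin

text \<open>
  The spaces \<open>X\<close> and \<open>V\<close> are the Banach-space types \<open>'a\<close> and \<open>'b\<close>; the continuous embedding of
  \<open>X\<close> in \<open>V\<close> is an explicit injective bounded linear map \<open>emb\<close>, so that the \<open>V\<close>-norm of \<open>u \<in> X\<close>
  is \<open>norm (emb u)\<close>. The values of \<open>symm\<close> and \<open>pol\<close> matter only on \<open>S\<close> and \<open>S \<times> Hs\<close>.
  The iterated polarization of \<open>u\<close> is a left fold; the polarizers are numbered from 0.
\<close>

locale symmetrization_framework =
  fixes emb :: "'a::banach \<Rightarrow> 'b::banach"
    and S :: "'a set"
    and Hs :: "'h::topological_space set"
    and symm :: "'a \<Rightarrow> 'a"
    and pol :: "'a \<Rightarrow> 'h \<Rightarrow> 'a"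
    and \<Theta> :: "'a \<Rightarrow> 'a"
  assumes emb_bounded_linear: "bounded_linear emb"
    and emb_inj: "inj emb"
    and Hs_path_connected: "path_connected Hs"
    and symm_in: "\<And>u. u \<in> S \<Longrightarrow> symm u \<in> S"
    and pol_in: "\<And>u H. u \<in> S \<Longrightarrow> H \<in> Hs \<Longrightarrow> pol u H \<in> S"
    and pol_continuous: "continuous_on (S \<times> Hs) (\<lambda>(u, H). pol u H)"
    and pol_symm: "\<And>u H. u \<in> S \<Longrightarrow> H \<in> Hs \<Longrightarrow> pol (symm u) H = symm u"
    and symm_pol: "\<And>u H. u \<in> S \<Longrightarrow> H \<in> Hs \<Longrightarrow> symm (pol u H) = symm u"
    and pol_idem: "\<And>u H. u \<in> S \<Longrightarrow> H \<in> Hs \<Longrightarrow> pol (pol u H) H = pol u H"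
    and approx_symm:
      "\<exists>H :: nat \<Rightarrow> 'h. range H \<subseteq> Hs \<and>
         (\<forall>u\<in>S. (\<lambda>m. emb (foldl pol u (map H [0..<m]))) \<longlonglongrightarrow> emb (symm u))"
    and pol_nonexpansive:
      "\<And>u v H. u \<in> S \<Longrightarrow> v \<in> S \<Longrightarrow> H \<in> Hs \<Longrightarrow>
         norm (emb (pol u H) - emb (pol v H)) \<le> norm (emb u - emb v)"
    and Theta_in: "\<And>u. \<Theta> u \<in> S"
    and Theta_id: "\<And>u. u \<in> S \<Longrightarrow> \<Theta> u = u"
    and Theta_lipschitz:
      "\<exists>L. \<forall>u v. norm (emb (\<Theta> u) - emb (\<Theta> v)) \<le> L * norm (emb u - emb v)"

definition symm_ext :: "('a \<Rightarrow> 'a) \<Rightarrow> ('a \<Rightarrow> 'a) \<Rightarrow> 'a \<Rightarrow> 'a" where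
  "symm_ext symm \<Theta> u = symm (\<Theta> u)"

definition weak_slope :: "('a::metric_space \<Rightarrow> real) \<Rightarrow> 'a \<Rightarrow> ennreal" where
  "weak_slope g u = Sup (ennreal ` {\<sigma>. 0 \<le> \<sigma> \<and>
     (\<exists>\<delta>>0. \<exists>\<H> :: 'a \<times> real \<Rightarrow> 'a.
        continuous_on (ball u \<delta> \<times> {0..\<delta>}) \<H> \<and>
        (\<forall>v\<in>ball u \<delta>. \<forall>t\<in>{0..\<delta>}.
           dist (\<H> (v, t)) v \<le> t \<and> g (\<H> (v, t)) \<le> g v - \<sigma> * t))})"

definition SBPS_sequence ::
  "('a::banach \<Rightarrow> 'b::banach) \<Rightarrow> ('a \<Rightarrow> 'a) \<Rightarrow> ('a \<Rightarrow> real) \<Rightarrow> real \<Rightarrow> (nat \<Rightarrow> 'a) \<Rightarrow> bool" where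
  "SBPS_sequence emb star g c u \<longleftrightarrow>
     bounded (range u) \<and>
     (\<lambda>n. weak_slope g (u n)) \<longlonglongrightarrow> 0 \<and>
     (\<lambda>n. g (u n)) \<longlonglongrightarrow> c \<and>
     (\<lambda>n. norm (emb (u n) - emb (star (u n)))) \<longlonglongrightarrow> 0"

text \<open>
  \<open>C(K; X)\<close>: the maps are made extensional (constantly \<open>undefined\<close> off \<open>K\<close>), so that each
  continuous map on \<open>K\<close> has exactly one representative and a set of such maps cannot
  depend on values outside \<open>K\<close>.
\<close>

definition cont_maps :: "'c::topological_space set \<Rightarrow> ('c \<Rightarrow> 'a::topological_space) set" where
  "cont_maps K = {\<gamma> \<in> extensional K. continuous_on K \<gamma>}"

definition admissible_maps ::
  "(real ^ 'm \<Rightarrow> 'a::topological_space) set \<Rightarrow> (real ^ 'm \<Rightarrow> 'a) set" where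
  "admissible_maps \<Gamma>0 = {\<gamma> \<in> cont_maps (cball 0 1). restrict \<gamma> (sphere 0 1) \<in> \<Gamma>0}"

text \<open>
  Both levels are extended reals, so that the infima and suprema have their usual meaning without
  boundedness assumptions. The condition \<open>boundary_level f \<Gamma>0 l < minimax_level f \<Gamma>0 l\<close>, with
  \<open>admissible_maps \<Gamma>0\<close> nonempty and \<open>f l\<close> continuous, forces both to be finite.
\<close>

definition minimax_level ::
  "(real \<Rightarrow> 'a::topological_space \<Rightarrow> real) \<Rightarrow> (real ^ 'm \<Rightarrow> 'a) set \<Rightarrow> real \<Rightarrow> ereal" where
  "minimax_level f \<Gamma>0 l =
     (INF \<gamma>\<in>admissible_maps \<Gamma>0. SUP t\<in>cball 0 1. ereal (f l (\<gamma> t)))"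

definition boundary_level ::
  "(real \<Rightarrow> 'a \<Rightarrow> real) \<Rightarrow> (real ^ 'm \<Rightarrow> 'a) set \<Rightarrow> real \<Rightarrow> ereal" where
  "boundary_level f \<Gamma>0 l = (SUP \<gamma>\<in>\<Gamma>0. SUP \<tau>\<in>sphere 0 1. ereal (f l (\<gamma> \<tau>)))"

end

theory Submission
  imports Defs
begin

text \<open>
  Call a parameter \<open>l\<close> good if some sequence \<open>ls h \<up> l\<close> keeps \<open>(c (ls h) - c l) / (l - ls h)\<close>
  bounded above. For an arbitrary function \<open>c\<close> the points that are not good, where the left
  derivative is \<open>-\<infinity>\<close>, form a null set: on countably many pieces \<open>c\<close> is decreasing and bounded
  and expands lengths by any prescribed factor.

  At a good \<open>l\<close> take maps \<open>\<gamma> h\<close> nearly optimal for \<open>ls h\<close>. On the part of \<open>\<gamma> h\<close> where \<open>f l\<close> is at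
  least \<open>c l - (l - ls h)\<close>, hypothesis (ii) gives a norm bound, and it forces the maximum of \<open>f l\<close>
  along \<open>\<gamma> h\<close> to tend to \<open>c l\<close>. Polarizing repeatedly, with polarizers that move to \<open>H0\<close> as the
  boundary is approached, also makes that part almost symmetric without increasing any \<open>f k\<close>.
  Finally Ekeland's principle, applied to the maps that agree with \<open>\<gamma> h\<close> wherever \<open>f l\<close> is below
  this threshold, yields a point of small weak slope close to that part of \<open>\<gamma> h\<close>; the localization
  has to be built into the class of competitors because \<open>f l\<close> is merely continuous.
\<close>

subsection \<open>Points of infinite left derivative\<close>

text \<open>\<open>N\<close> counts cells of length \<open>d\<close>. Inside one cell the expansion
  estimate confines \<open>B\<close> to an interval whose length is the oscillation of
  \<open>c\<close> there divided by \<open>K\<close>. Since \<open>c\<close> decreases from cell to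
  cell, the ranges used by different cells overlap at most in endpoints, so the lengths add up to at
  most \<open>(hi - lo) / K\<close>, independently of \<open>N\<close>.\<close>

lemma expanding_antimono_cover:
  fixes c :: "real \<Rightarrow> real"
  assumes "B \<subseteq> {x0..<x0 + real N * d}" and "K > 0" and "lo \<le> hi" and "c ` B \<subseteq> {lo..hi}"
    and "\<And>x y. x \<in> B \<Longrightarrow> y \<in> B \<Longrightarrow> x < y \<Longrightarrow> c y \<le> c x"
    and "\<And>x y. x \<in> B \<Longrightarrow> y \<in> B \<Longrightarrow> x < y \<Longrightarrow> y - x < d \<Longrightarrow> K * (y - x) \<le> c x - c y"
  shows "\<exists>E\<in>sets lebesgue. B \<subseteq> E \<and> emeasure lebesgue E \<le> ennreal ((hi - lo) / K)"
  using assms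
proof (induction N arbitrary: B x0 hi)
  case 0
  then have "B = {}" by auto
  then show ?case by (intro bexI[of _ "{}"]) auto
next
  case (Suc N)
  define B1 where "B1 = B \<inter> {..<x0 + d}"
  define B2 where "B2 = B \<inter> {x0 + d..}"
  have B: "B = B1 \<union> B2" and sub: "B1 \<subseteq> B" "B2 \<subseteq> B"
    by (auto simp: B1_def B2_def)
  have rng: "lo \<le> c x" "c x \<le> hi" if "x \<in> B" for x
    using Suc.prems(4) that by auto
  have rng1: "lo \<le> c x" "c x \<le> hi" if "x \<in> B1" for x
    using rng that sub by blast+
  have B2: "B2 \<subseteq> {x0 + d..<x0 + d + real N * d}"
    using Suc.prems(1) by (auto simp: B2_def algebra_simps)
  show ?case
  proof (cases "B1 = {}")
    case True
    with B have "B = B2" by simp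
    then show ?thesis
      using B2 Suc.IH[of B2 "x0 + d" hi] Suc.prems by simp
  next
    case False
    \<comment> \<open>\<open>mid\<close> divides the available range: the first cell uses
      \<open>{mid..hi}\<close> and, by monotonicity, all later points have values in
      \<open>{lo..mid}\<close>, which is what the induction hypothesis receives.\<close>
    define mid where "mid = Inf (c ` B1)"
    have bdd: "bdd_below (c ` B1)"
      using rng1 by (intro bdd_belowI[of _ lo]) auto
    have mid: "mid \<le> c x" if "x \<in> B1" for x
      using that bdd by (simp add: mid_def cInf_lower)
    have lm: "lo \<le> mid"
      unfolding mid_def using False rng1 by (intro cInf_greatest) auto
    have mh: "mid \<le> hi"
      using False mid rng1(2) by (meson all_not_in_conv order_trans)
    have "c y \<le> mid" if "y \<in> B2" for y
      unfolding mid_def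
    proof (rule cInf_greatest)
      fix v assume "v \<in> c ` B1"
      then obtain x where "x \<in> B1" "v = c x" by auto
      then show "c y \<le> v"
        using that Suc.prems(5)[of x y] by (auto simp: B1_def B2_def)
    qed (use False in auto)
    then have cB2: "c ` B2 \<subseteq> {lo..mid}"
      using rng sub by auto
    obtain E2 where E2: "E2 \<in> sets lebesgue" "B2 \<subseteq> E2"
      "emeasure lebesgue E2 \<le> ennreal ((mid - lo) / K)"
      using Suc.IH[OF B2 \<open>K > 0\<close> lm cB2 Suc.prems(5,6)] sub by blast
    define a where "a = Inf B1"
    have bddB: "bdd_below B1"
      using Suc.prems(1) sub by (intro bdd_belowI[of _ x0]) auto
    have near: "y - (hi - mid) / K \<le> a" if "y \<in> B1" for y
      unfolding a_def
    proof (rule cInf_greatest)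
      fix x assume x: "x \<in> B1"
      have cx: "c x - c y \<le> hi - mid"
        using mid[OF that] rng1(2)[OF x] by simp
      have "y - x \<le> (hi - mid) / K"
      proof (cases "x < y")
        case True
        have "x0 \<le> x" "y < x0 + d"
          using Suc.prems(1) x that sub by (auto simp: B1_def)
        then have "K * (y - x) \<le> c x - c y"
          using Suc.prems(6)[of x y] x that sub True by (simp add: subset_iff)
        then show ?thesis
          using cx \<open>K > 0\<close> by (simp add: field_simps)
      next
        case False
        then show ?thesis
          using mh \<open>K > 0\<close> by (smt (verit) divide_nonneg_pos)
      qed
      then show "y - (hi - mid) / K \<le> x" by simp
    qed (use False in auto)
    have B1: "B1 \<subseteq> {a..a + (hi - mid) / K}"
      using near bddB by (force simp: a_def intro: cInf_lower)
    moreover have "emeasure lebesgue {a..a + (hi - mid) / K} = ennreal ((hi - mid) / K)"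
      using mh \<open>K > 0\<close> by simp
    moreover have "emeasure lebesgue ({a..a + (hi - mid) / K} \<union> E2)
        \<le> emeasure lebesgue {a..a + (hi - mid) / K} + emeasure lebesgue E2"
      using E2 by (intro emeasure_subadditive) auto
    ultimately have "emeasure lebesgue ({a..a + (hi - mid) / K} \<union> E2)
        \<le> ennreal ((hi - mid) / K) + ennreal ((mid - lo) / K)"
      using E2(3) by (metis add_left_mono order_trans)
    also have "\<dots> = ennreal ((hi - lo) / K)"
      using mh lm \<open>K > 0\<close> by (simp add: field_simps flip: ennreal_plus)
    finally show ?thesis
      using E2 B1 B by (intro bexI[of _ "{a..a + (hi - mid) / K} \<union> E2"]) auto
  qed
qed

text \<open>
  Outer measure, because the sets on which a uniform modulus holds need not be measurable.
\<close>

lemma negligible_antimono_left_derivative_infinite: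
  fixes c :: "real \<Rightarrow> real"
  assumes A: "A \<subseteq> {p..<q}" and R: "\<And>x. x \<in> A \<Longrightarrow> \<bar>c x\<bar> \<le> R"
    and anti: "\<And>x y. x \<in> A \<Longrightarrow> y \<in> A \<Longrightarrow> x < y \<Longrightarrow> c y \<le> c x"
    and lim: "\<And>x. x \<in> A \<Longrightarrow> filterlim (\<lambda>y. (c y - c x) / (x - y)) at_top (at_left x)"
  shows "negligible A"
proof (cases "A = {}")
  case False
  then have "R \<ge> 0" using R by fastforce
  have le: "outer_measure_of lebesgue A \<le> ennreal (2 * R / K)" if "K > 0" for K
  proof -
    \<comment> \<open>The lower bound \<open>K\<close> for the quotient is made uniform: on
      \<open>B m\<close> it holds up to distance \<open>1 / Suc m\<close>, the cell length used
      below. The sets increase to \<open>A\<close>, and outer measure is continuous along increasing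
      sequences, so a bound common to all \<open>B m\<close> passes to \<open>A\<close>.\<close>
    define B where
      "B m = {x \<in> A. \<forall>y. x - 1 / Suc m < y \<longrightarrow> y < x \<longrightarrow> K * (x - y) \<le> c y - c x}" for m
    have "incseq B"
    proof (rule incseq_SucI, rule subsetI)
      fix m x assume x: "x \<in> B m"
      have "1 / real (Suc (Suc m)) \<le> 1 / real (Suc m)" by (simp add: frac_le)
      with x show "x \<in> B (Suc m)"
        by (force simp: B_def)
    qed
    have "(\<Union>m. B m) = A"
    proof (intro equalityI subsetI)
      fix x assume x: "x \<in> A"
      have "eventually (\<lambda>y. K \<le> (c y - c x) / (x - y)) (at_left x)"
        using lim[OF x] by (simp add: filterlim_at_top)
      then obtain b where b: "b < x" "\<And>y. b < y \<Longrightarrow> y < x \<Longrightarrow> K \<le> (c y - c x) / (x - y)"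
        unfolding eventually_at_left_field by auto
      obtain m where m: "inverse (real (Suc m)) < x - b"
        using reals_Archimedean[of "x - b"] b(1) by auto
      have "x \<in> B m"
        unfolding B_def
      proof (intro CollectI conjI allI impI x)
        fix y assume y: "x - 1 / Suc m < y" "y < x"
        then have "K \<le> (c y - c x) / (x - y)"
          using m by (intro b(2)) (auto simp: inverse_eq_divide)
        then show "K * (x - y) \<le> c y - c x"
          using y by (simp add: pos_le_divide_eq)
      qed
      then show "x \<in> (\<Union>m. B m)" by blast
    qed (auto simp: B_def)
    have "outer_measure_of lebesgue (B m) \<le> ennreal (2 * R / K)" for m
    proof -
      obtain N where N: "(q - p) / (1 / Suc m) \<le> real N"
        using real_arch_simple by blast
      then have qN: "q \<le> p + real N * (1 / Suc m)"
        by (simp add: field_simps)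
      have "\<exists>E\<in>sets lebesgue. B m \<subseteq> E \<and> emeasure lebesgue E \<le> ennreal ((R - - R) / K)"
      proof (rule expanding_antimono_cover[OF _ \<open>K > 0\<close>])
        show "B m \<subseteq> {p..<p + real N * (1 / Suc m)}"
        proof
          fix x assume "x \<in> B m"
          then have "x \<in> {p..<q}" using A by (auto simp: B_def)
          then show "x \<in> {p..<p + real N * (1 / Suc m)}" using qN by simp
        qed
        show "c ` B m \<subseteq> {- R..R}"
          using R by (force simp: B_def abs_le_iff)
      next
        fix x y assume xy: "x \<in> B m" "y \<in> B m" "x < y"
        then show "c y \<le> c x" using anti by (simp add: B_def)
        assume "y - x < 1 / Suc m"
        then have "y - 1 / Suc m < x" by simp
        then show "K * (y - x) \<le> c x - c y" using xy unfolding B_def by blast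
      qed (use \<open>R \<ge> 0\<close> in auto)
      then obtain E where E: "E \<in> sets lebesgue" "B m \<subseteq> E"
        "emeasure lebesgue E \<le> ennreal (2 * R / K)"
        by auto
      then show ?thesis
        by (metis outer_measure_of_eq outer_measure_of_mono order_trans)
    qed
    then have "(SUP m. outer_measure_of lebesgue (B m)) \<le> ennreal (2 * R / K)"
      by (rule SUP_least)
    then show ?thesis
      using SUP_outer_measure_of_incseq[of B lebesgue] \<open>incseq B\<close> \<open>(\<Union>m. B m) = A\<close> by simp
  qed
  \<comment> \<open>\<open>K = 2 * R / e\<close> turns the bound into \<open>e\<close>. For
    \<open>R = 0\<close> this \<open>K\<close> is not positive, but then any positive
    \<open>K\<close> already gives outer measure zero.\<close>
  have eps: "outer_measure_of lebesgue A \<le> 0 + ennreal e" if "e > 0" for e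
  proof (cases "R = 0")
    case True
    then show ?thesis using le[of 1] by simp
  next
    case False
    then show ?thesis using le[of "2 * R / e"] that \<open>R \<ge> 0\<close> by simp
  qed
  have "outer_measure_of lebesgue A \<le> 0"
    by (rule ennreal_le_epsilon) (rule eps)
  then obtain E where "E \<in> sets lebesgue" "A \<subseteq> E" "emeasure lebesgue E = 0"
    using outer_measure_of_attain[of A lebesgue] by auto
  then have "E \<in> null_sets lebesgue" by blast
  then show ?thesis
    using negligible_subset[OF _ \<open>A \<subseteq> E\<close>] unfolding negligible_iff_null_sets by blast
qed auto

text \<open>An infinite limit makes the quotient eventually nonnegative, so just to the left of
  \<open>x\<close> the values of \<open>c\<close> are at least \<open>c x\<close>. On short pieces
  with a uniform modulus this local inequality becomes monotonicity, and countably many such pieces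
  suffice.\<close>

lemma negligible_left_derivative_infinite:
  fixes c :: "real \<Rightarrow> real"
  shows "negligible {x. filterlim (\<lambda>y. (c y - c x) / (x - y)) at_top (at_left x)}"
proof -
  define N where "N = {x. filterlim (\<lambda>y. (c y - c x) / (x - y)) at_top (at_left x)}"
  \<comment> \<open>\<open>n\<close> fixes how far to the left \<open>c x \<le> c y\<close> holds,
    \<open>R\<close> bounds \<open>c\<close>, and \<open>j\<close> selects a grid cell of length
    \<open>1 / Suc n\<close>, so that any two points of one piece are close enough for the
    inequality.\<close>
  define A where "A = (\<lambda>(n :: nat, R :: nat, j :: int). {x \<in> N. x \<in> {j / Suc n..<(j + 1) / Suc n} \<and>
     \<bar>c x\<bar> \<le> R \<and> (\<forall>y. x - 1 / Suc n < y \<longrightarrow> y < x \<longrightarrow> c x \<le> c y)})"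
  have "negligible (A k)" for k
  proof (cases k)
    case (fields n R j)
    show ?thesis
    proof (rule negligible_antimono_left_derivative_infinite)
      show "A k \<subseteq> {j / Suc n..<(j + 1) / Suc n}"
        by (auto simp: A_def fields)
      show "\<And>x. x \<in> A k \<Longrightarrow> \<bar>c x\<bar> \<le> real R"
        by (auto simp: A_def fields)
      show "\<And>x. x \<in> A k \<Longrightarrow> filterlim (\<lambda>y. (c y - c x) / (x - y)) at_top (at_left x)"
        by (auto simp: A_def fields N_def)
      fix x y assume xy: "x \<in> A k" "y \<in> A k" "x < y"
      have "y < (j + 1) / Suc n" "j / Suc n \<le> x"
        using xy by (auto simp: A_def fields)
      moreover have "(j + 1) / Suc n = j / Suc n + 1 / Suc n"
        by (simp add: add_divide_distrib)
      ultimately have "y - 1 / Suc n < x" by linarith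
      then show "c y \<le> c x"
        using xy by (auto simp: A_def fields)
    qed
  qed
  then have "negligible (\<Union>(range A))"
    by (intro negligible_countable_Union) auto
  moreover have "N \<subseteq> \<Union>(range A)"
  proof
    fix x assume x: "x \<in> N"
    then have "eventually (\<lambda>y. 0 \<le> (c y - c x) / (x - y)) (at_left x)"
      by (simp add: filterlim_at_top N_def)
    then obtain b where b: "b < x" "\<And>y. b < y \<Longrightarrow> y < x \<Longrightarrow> 0 \<le> (c y - c x) / (x - y)"
      unfolding eventually_at_left_field by auto
    obtain n where n: "inverse (real (Suc n)) < x - b"
      using reals_Archimedean[of "x - b"] b(1) by auto
    obtain R where R: "\<bar>c x\<bar> \<le> real R"
      using real_arch_simple by blast
    define j where "j = \<lfloor>x * Suc n\<rfloor>"
    have "c x \<le> c y" if "x - 1 / Suc n < y" "y < x" for y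
      using b(2)[of y] that n by (auto simp: inverse_eq_divide zero_le_divide_iff)
    moreover have "x \<in> {j / Suc n..<(j + 1) / Suc n}"
      unfolding j_def by (auto simp: field_simps) (use floor_correct[of "x * Suc n"] in \<open>auto simp: algebra_simps\<close>)
    ultimately have "x \<in> A (n, R, j)"
      using x R by (auto simp: A_def)
    then show "x \<in> \<Union>(range A)" by blast
  qed
  ultimately show ?thesis
    unfolding N_def by (rule negligible_subset)
qed

text \<open>Divergence fails for some \<open>M\<close>, so points with quotient below
  \<open>M\<close> exist arbitrarily close to \<open>x\<close> on the left. Dependent choice makes
  them increase, and the extra requirement \<open>x - 1 / Suc n < ls n\<close> forces
  convergence.\<close>

lemma left_quotient_bounded_sequence:
  fixes c :: "real \<Rightarrow> real"
  assumes "\<not> filterlim (\<lambda>y. (c y - c x) / (x - y)) at_top (at_left x)" and "a < x"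
  obtains M ls where "strict_mono ls" "ls \<longlonglongrightarrow> x" "\<And>n. a < ls n" "\<And>n::nat. ls n < x"
    "\<And>n. c (ls n) - c x \<le> M * (x - ls n)"
proof -
  obtain M where M: "\<not> eventually (\<lambda>y. M \<le> (c y - c x) / (x - y)) (at_left x)"
    using assms(1) by (auto simp: filterlim_at_top)
  have ex: "\<exists>y. b < y \<and> y < x \<and> c y - c x \<le> M * (x - y)" if b: "b < x" for b
  proof -
    have "\<not> (\<forall>y>b. y < x \<longrightarrow> M \<le> (c y - c x) / (x - y))"
      using M b unfolding eventually_at_left_field by auto
    then obtain y where "b < y" "y < x" "(c y - c x) / (x - y) < M" by force
    then show ?thesis
      by (intro exI[of _ y]) (auto simp: pos_divide_less_eq)
  qed
  have "\<exists>ls :: nat \<Rightarrow> real. \<forall>n. (a < ls n \<and> ls n < x \<and> x - 1 / Suc n < ls n \<and>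
      c (ls n) - c x \<le> M * (x - ls n)) \<and> ls n < ls (Suc n)"
  proof (rule dependent_nat_choice)
    show "\<exists>y. a < y \<and> y < x \<and> x - 1 / real (Suc 0) < y \<and> c y - c x \<le> M * (x - y)"
      using ex[of "max a (x - 1)"] assms(2) by auto
    fix y n assume y: "a < y \<and> y < x \<and> x - 1 / real (Suc n) < y \<and> c y - c x \<le> M * (x - y)"
    obtain z where "max y (x - 1 / real (Suc (Suc n))) < z" "z < x" "c z - c x \<le> M * (x - z)"
      using ex[of "max y (x - 1 / real (Suc (Suc n)))"] y by auto
    with y show "\<exists>z. (a < z \<and> z < x \<and> x - 1 / real (Suc (Suc n)) < z \<and> c z - c x \<le> M * (x - z)) \<and> y < z"
      by (intro exI[of _ z]) simp
  qed
  then obtain ls :: "nat \<Rightarrow> real" where ls: "\<And>n. a < ls n" "\<And>n. ls n < x" "\<And>n. x - 1 / Suc n < ls n"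
      "\<And>n. c (ls n) - c x \<le> M * (x - ls n)" "\<And>n. ls n < ls (Suc n)"
    by blast
  have "(\<lambda>n. x - 1 / Suc n) \<longlonglongrightarrow> x - 0"
    using LIMSEQ_inverse_real_of_nat by (intro tendsto_intros) (simp add: inverse_eq_divide)
  then have "ls \<longlonglongrightarrow> x"
    using ls(2,3) by (intro real_tendsto_sandwich[of "\<lambda>n. x - 1 / Suc n" ls _ "\<lambda>_. x"])
      (auto intro!: always_eventually less_imp_le)
  then show ?thesis
    using that[of ls M] ls by (simp add: strict_mono_Suc_iff)
qed

subsection \<open>Ekeland's principle and the weak slope\<close>

text \<open>\<open>L x\<close> is the lower set of \<open>x\<close> in Ekeland's order. A descending
  chain that nearly minimizes \<Phi> on each lower set has lower sets shrinking to its limit, so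
  nothing lies strictly below the limit. Lower semicontinuity is phrased as closedness of sublevels
  along sequences in \<open>S\<close>, a form that a supremum of continuous functions inherits
  pointwise.\<close>

lemma ekeland:
  fixes \<Phi> :: "'a::metric_space \<Rightarrow> real"
  assumes S: "complete S" and x0: "x0 \<in> S" and low: "\<And>x. x \<in> S \<Longrightarrow> m \<le> \<Phi> x"
    and lsc: "\<And>a X x. (\<And>n::nat. X n \<in> S \<and> \<Phi> (X n) \<le> a) \<Longrightarrow> X \<longlonglongrightarrow> x \<Longrightarrow> x \<in> S \<Longrightarrow> \<Phi> x \<le> a"
    and "\<sigma> > 0"
  obtains x where "x \<in> S" "\<Phi> x + \<sigma> * dist x0 x \<le> \<Phi> x0"
    "\<And>y. y \<in> S \<Longrightarrow> y \<noteq> x \<Longrightarrow> \<Phi> x < \<Phi> y + \<sigma> * dist x y"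
proof -
  define L where "L x = {y \<in> S. \<Phi> y + \<sigma> * dist x y \<le> \<Phi> x}" for x
  have self: "x \<in> L x" if "x \<in> S" for x
    using that by (simp add: L_def)
  have trans: "L y \<subseteq> L x" if "y \<in> L x" for x y
  proof
    fix z assume "z \<in> L y"
    moreover have "\<sigma> * dist x z \<le> \<sigma> * dist x y + \<sigma> * dist y z"
      using dist_triangle[of x z y] \<open>\<sigma> > 0\<close> by (simp flip: distrib_left)
    ultimately show "z \<in> L x"
      using that by (auto simp: L_def)
  qed
  have bdd: "bdd_below (\<Phi> ` L x)" for x
    using low by (intro bdd_belowI[of _ m]) (auto simp: L_def)
  have ex: "\<exists>y \<in> L x. \<forall>z\<in>L x. \<Phi> y \<le> \<Phi> z + e" if xS: "x \<in> S" and "e > 0" for x e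
  proof -
    have "Inf (\<Phi> ` L x) < Inf (\<Phi> ` L x) + e" using that by simp
    then obtain y where y: "y \<in> L x" "\<Phi> y < Inf (\<Phi> ` L x) + e"
      using self[OF xS] by (subst (asm) cInf_less_iff) (auto simp: bdd)
    have "\<Phi> y \<le> \<Phi> z + e" if "z \<in> L x" for z
      using y(2) cInf_lower[OF imageI[OF that] bdd] by linarith
    with y(1) show ?thesis by blast
  qed
  have "\<exists>X :: nat \<Rightarrow> 'a. \<forall>n. (X n \<in> L x0) \<and>
      (X (Suc n) \<in> L (X n) \<and> (\<forall>z\<in>L (X n). \<Phi> (X (Suc n)) \<le> \<Phi> z + (1/2) ^ n))"
  proof (rule dependent_nat_choice)
    show "\<exists>x. x \<in> L x0" using self[OF x0] by blast
    fix x n assume x: "x \<in> L x0"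
    then have "x \<in> S" by (simp add: L_def)
    then obtain y where "y \<in> L x" "\<forall>z\<in>L x. \<Phi> y \<le> \<Phi> z + (1/2) ^ n"
      using ex[of x "(1/2) ^ n"] by auto
    then show "\<exists>y. y \<in> L x0 \<and> (y \<in> L x \<and> (\<forall>z\<in>L x. \<Phi> y \<le> \<Phi> z + (1/2) ^ n))"
      using trans[OF x] by blast
  qed
  then obtain X :: "nat \<Rightarrow> 'a" where X0: "\<And>n. X n \<in> L x0" and XS: "\<And>n. X (Suc n) \<in> L (X n)"
    and Xmin: "\<And>n z. z \<in> L (X n) \<Longrightarrow> \<Phi> (X (Suc n)) \<le> \<Phi> z + (1/2) ^ n"
    by blast
  have inS: "X n \<in> S" for n using X0 by (auto simp: L_def)
  have chain: "X (n + k) \<in> L (X n)" for n k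
  proof (induction k)
    case (Suc k)
    then show ?case using trans XS by fastforce
  qed (simp add: self inS)
  \<comment> \<open>\<open>X (Suc n)\<close> nearly minimizes \<Phi> on \<open>L (X n)\<close>,
    which contains \<open>L (X (Suc n))\<close>. A point below \<open>X (Suc n)\<close> can
    therefore save at most \<open>(1/2) ^ n\<close>, and this saving pays for its distance.\<close>
  have diam: "\<sigma> * dist (X (Suc n)) z \<le> (1/2) ^ n" if "z \<in> L (X (Suc n))" for n z
  proof -
    have "z \<in> L (X n)" using that trans[OF XS] by blast
    then show ?thesis using Xmin[of z n] that by (auto simp: L_def)
  qed
  have pw: "(\<lambda>n. (1/2) ^ n / \<sigma>) \<longlonglongrightarrow> 0"
    using tendsto_divide[OF LIMSEQ_power_zero[of "1/2::real"] tendsto_const[of \<sigma>]] \<open>\<sigma> > 0\<close> by simp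
  have "Cauchy X"
  proof (rule CauchyI')
    fix e :: real assume "e > 0"
    then obtain n where n: "(1/2) ^ n / \<sigma> < e / 2"
      using order_tendstoD(2)[OF pw, of "e / 2"] by (auto dest: eventually_happens)
    have "dist (X i) (X j) < e" if "i \<ge> Suc n" "j > i" for i j
    proof -
      have "X i \<in> L (X (Suc n))" "X j \<in> L (X (Suc n))"
        using chain[of "Suc n" "i - Suc n"] chain[of "Suc n" "j - Suc n"] that by auto
      then have "dist (X (Suc n)) (X i) \<le> (1/2) ^ n / \<sigma>" "dist (X (Suc n)) (X j) \<le> (1/2) ^ n / \<sigma>"
        using diam \<open>\<sigma> > 0\<close> by (auto simp: field_simps)
      then show ?thesis
        using n dist_triangle3[of "X i" "X j" "X (Suc n)"] by linarith
    qed
    then show "\<exists>M. \<forall>m\<ge>M. \<forall>n>m. dist (X m) (X n) < e" by blast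
  qed
  then obtain x where x: "x \<in> S" "X \<longlonglongrightarrow> x"
    using S inS unfolding complete_def by blast
  have xL: "x \<in> L (X n)" for n
  proof -
    \<comment> \<open>\<open>lsc\<close> needs one constant bound for a whole sequence, so the
      distance from \<open>X n\<close> to the tail is replaced by \<open>dist (X n) x - e\<close>,
      valid from index \<open>K\<close> on; afterwards \<open>e\<close> tends to 0.\<close>
    have le: "\<Phi> x \<le> \<Phi> (X n) - \<sigma> * (dist (X n) x - e)" if "e > 0" for e
    proof -
      have "eventually (\<lambda>k. dist (X k) x < e) sequentially"
        using x(2) that by (rule tendstoD)
      then obtain K where K: "\<And>k. k \<ge> K \<Longrightarrow> dist (X k) x < e"
        by (auto simp: eventually_sequentially)
      have "\<Phi> (X (n + (K + k))) \<le> \<Phi> (X n) - \<sigma> * (dist (X n) x - e)" for k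
      proof -
        have "dist (X n) x - e \<le> dist (X n) (X (n + (K + k)))"
          using K[of "n + (K + k)"] dist_triangle[of "X n" x "X (n + (K + k))"] by simp
        then have "\<sigma> * (dist (X n) x - e) \<le> \<sigma> * dist (X n) (X (n + (K + k)))"
          using \<open>\<sigma> > 0\<close> by simp
        then show ?thesis
          using chain[of n "K + k"] by (auto simp: L_def)
      qed
      moreover have "(\<lambda>k. X (n + (K + k))) \<longlonglongrightarrow> x"
        using LIMSEQ_ignore_initial_segment[OF x(2), of "n + K"] by (simp add: ac_simps)
      ultimately show ?thesis
        using lsc[of "\<lambda>k. X (n + (K + k))"] inS x(1) by blast
    qed
    have "\<Phi> x + \<sigma> * dist (X n) x \<le> \<Phi> (X n) + e" if "e > 0" for e
      using le[of "e / \<sigma>"] that \<open>\<sigma> > 0\<close> by (simp add: algebra_simps)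
    then have "\<Phi> x + \<sigma> * dist (X n) x \<le> \<Phi> (X n)"
      by (rule field_le_epsilon)
    then show ?thesis using x(1) by (simp add: L_def)
  qed
  show ?thesis
  proof
    show "x \<in> S" by fact
    show "\<Phi> x + \<sigma> * dist x0 x \<le> \<Phi> x0"
      using trans[OF X0] xL by (force simp: L_def)
    fix y assume y: "y \<in> S" "y \<noteq> x"
    show "\<Phi> x < \<Phi> y + \<sigma> * dist x y"
    proof (rule ccontr)
      assume "\<not> ?thesis"
      then have "y \<in> L x" using y by (simp add: L_def)
      then have yL: "y \<in> L (X n)" for n using trans[OF xL] by blast
      have "dist x y \<le> 2 * ((1/2) ^ n / \<sigma>)" for n
      proof -
        have "dist (X (Suc n)) x \<le> (1/2) ^ n / \<sigma>" "dist (X (Suc n)) y \<le> (1/2) ^ n / \<sigma>"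
          using diam[OF xL] diam[OF yL] \<open>\<sigma> > 0\<close> by (auto simp: field_simps)
        then show ?thesis
          using dist_triangle3[of x y "X (Suc n)"] by linarith
      qed
      then have "dist x y \<le> 2 * 0"
        by (intro LIMSEQ_le_const[OF tendsto_mult[OF tendsto_const pw]]) auto
      then show False using y by simp
    qed
  qed
qed

section \<open>Lowering a map where the weak slope is large\<close>

lemma less_weak_slopeE:
  fixes g :: "'a::metric_space \<Rightarrow> real"
  assumes "ennreal \<sigma> < weak_slope g u" "\<sigma> \<ge> 0"
  obtains \<delta> \<H> where "\<delta> > 0" "continuous_on (ball u \<delta> \<times> {0..\<delta>}) \<H>"
    "\<And>v t. v \<in> ball u \<delta> \<Longrightarrow> t \<in> {0..\<delta>} \<Longrightarrow> dist (\<H> (v, t)) v \<le> t \<and> g (\<H> (v, t)) \<le> g v - \<sigma> * t"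
proof -
  obtain \<sigma>' \<delta> and \<H> :: "'a \<times> real \<Rightarrow> 'a"
    where *: "0 \<le> \<sigma>'" "ennreal \<sigma> < ennreal \<sigma>'" "\<delta> > 0"
    "continuous_on (ball u \<delta> \<times> {0..\<delta>}) \<H>"
    "\<And>v t. v \<in> ball u \<delta> \<Longrightarrow> t \<in> {0..\<delta>} \<Longrightarrow> dist (\<H> (v, t)) v \<le> t \<and> g (\<H> (v, t)) \<le> g v - \<sigma>' * t"
    using assms unfolding weak_slope_def less_Sup_iff by blast
  then have "\<sigma> * t \<le> \<sigma>' * t" if "t \<ge> 0" for t
    using that assms(2) by (intro mult_right_mono) (auto simp: ennreal_less_iff)
  with * show ?thesis
    by (intro that[of \<delta> \<H>]) (auto, smt (verit))
qed

text \<open>The local deformations are applied one after another, the one at \<open>u\<close> for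
  time \<open>\<theta> u x\<close>, so no linear structure is needed and the decreases add up. It
  starts to act only where \<open>\<gamma> x\<close> is in the half ball, and the total displacement
  is at most \<open>b\<close>, less than half the radius; hence every deformation is evaluated
  inside its own ball.\<close>

lemma combine_deformations:
  fixes \<gamma> :: "'c::topological_space \<Rightarrow> 'a::metric_space"
  assumes "finite I" and \<gamma>: "continuous_on D \<gamma>"
    and "\<And>u. u \<in> I \<Longrightarrow> continuous_on (ball u (\<delta> u) \<times> {0..\<delta> u}) (\<H> u)"
    and "\<And>u v t. u \<in> I \<Longrightarrow> v \<in> ball u (\<delta> u) \<Longrightarrow> t \<in> {0..\<delta> u} \<Longrightarrow>
      dist (\<H> u (v, t)) v \<le> t \<and> g (\<H> u (v, t)) \<le> g v - \<sigma> * t"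
    and "\<And>u. u \<in> I \<Longrightarrow> continuous_on D (\<theta> u)"
    and "\<And>u x. u \<in> I \<Longrightarrow> x \<in> D \<Longrightarrow> 0 \<le> \<theta> u x"
    and "\<And>u x. u \<in> I \<Longrightarrow> x \<in> D \<Longrightarrow> 0 < \<theta> u x \<Longrightarrow> dist u (\<gamma> x) < \<delta> u / 2"
    and "\<And>x. x \<in> D \<Longrightarrow> (\<Sum>u\<in>I. \<theta> u x) \<le> b"
    and "\<And>u. u \<in> I \<Longrightarrow> b < \<delta> u / 2"
  shows "\<exists>\<eta>. continuous_on D \<eta> \<and> (\<forall>x\<in>D. dist (\<eta> x) (\<gamma> x) \<le> (\<Sum>u\<in>I. \<theta> u x) \<and>
    g (\<eta> x) \<le> g (\<gamma> x) - \<sigma> * (\<Sum>u\<in>I. \<theta> u x))"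
  using assms(1,3-)
proof (induction I rule: finite_induct)
  case empty
  then show ?case using \<gamma> by (intro exI[of _ \<gamma>]) auto
next
  case (insert j I)
  have th0: "0 \<le> \<theta> j x" and sum0: "0 \<le> (\<Sum>u\<in>I. \<theta> u x)" if "x \<in> D" for x
    using insert.prems(4) that by (auto intro!: sum_nonneg)
  have ins: "(\<Sum>u\<in>insert j I. \<theta> u x) = \<theta> j x + (\<Sum>u\<in>I. \<theta> u x)" for x
    using insert.hyps by simp
  have sb: "\<theta> j x \<le> b" "(\<Sum>u\<in>I. \<theta> u x) \<le> b" "\<theta> j x + (\<Sum>u\<in>I. \<theta> u x) \<le> b" if "x \<in> D" for x
    using insert.prems(6)[OF that] th0[OF that] sum0[OF that] unfolding ins by linarith+
  have "\<exists>\<eta>. continuous_on D \<eta> \<and> (\<forall>x\<in>D. dist (\<eta> x) (\<gamma> x) \<le> (\<Sum>u\<in>I. \<theta> u x) \<and>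
    g (\<eta> x) \<le> g (\<gamma> x) - \<sigma> * (\<Sum>u\<in>I. \<theta> u x))"
    by (rule insert.IH) (use insert.prems sb in auto)
  then obtain \<eta> where \<eta>: "continuous_on D \<eta>"
    "\<And>x. x \<in> D \<Longrightarrow> dist (\<eta> x) (\<gamma> x) \<le> (\<Sum>u\<in>I. \<theta> u x)"
    "\<And>x. x \<in> D \<Longrightarrow> g (\<eta> x) \<le> g (\<gamma> x) - \<sigma> * (\<Sum>u\<in>I. \<theta> u x)"
    by blast
  have b: "b < \<delta> j / 2" using insert.prems(7) by simp
  have Hj: "dist (\<H> j (v, t)) v \<le> t" "g (\<H> j (v, t)) \<le> g v - \<sigma> * t"
    if "v \<in> ball j (\<delta> j)" "t \<in> {0..\<delta> j}" for v t
    using insert.prems(2)[of j v t] that by auto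
  \<comment> \<open>The new map is glued along two relatively closed pieces. Since
    \<open>\<theta> j x > 0\<close> is not a closed condition, \<open>C2\<close> uses the closed
    half ball instead; on the overlap \<open>\<theta> j x = 0\<close>, and a deformation at time 0
    moves nothing.\<close>
  define C1 where "C1 = D \<inter> \<theta> j -` {0}"
  define C2 where "C2 = D \<inter> (\<lambda>x. dist j (\<gamma> x)) -` {..\<delta> j / 2}"
  have C2: "\<eta> x \<in> ball j (\<delta> j)" "\<theta> j x \<in> {0..\<delta> j}" if "x \<in> C2" for x
  proof -
    have "x \<in> D" "dist j (\<gamma> x) \<le> \<delta> j / 2" using that by (auto simp: C2_def)
    then show "\<eta> x \<in> ball j (\<delta> j)" "\<theta> j x \<in> {0..\<delta> j}"
      using \<eta>(2)[of x] sb[of x] b th0[of x] sum0[of x] dist_triangle[of j "\<eta> x" "\<gamma> x"]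
      by (auto simp: dist_commute)
  qed
  have inC: "x \<in> C2" if "x \<in> D" "\<theta> j x \<noteq> 0" for x
    using insert.prems(5)[of j x] that th0[OF that(1)] by (auto simp: C2_def)
  have D: "D = C1 \<union> C2"
    using inC by (auto simp: C1_def C2_def)
  define \<eta>' where "\<eta>' x = (if \<theta> j x = 0 then \<eta> x else \<H> j (\<eta> x, \<theta> j x))" for x
  have "continuous_on (C1 \<union> C2) \<eta>'"
    unfolding \<eta>'_def
  proof (rule continuous_on_cases_local)
    show "closedin (top_of_set (C1 \<union> C2)) C1"
      unfolding D[symmetric] unfolding C1_def using insert.prems(3)[of j]
      by (intro continuous_closedin_preimage) auto
    show "closedin (top_of_set (C1 \<union> C2)) C2"
      unfolding D[symmetric] unfolding C2_def using \<gamma>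
      by (intro continuous_closedin_preimage continuous_intros) auto
    show "continuous_on C1 \<eta>"
      using \<eta>(1) by (rule continuous_on_subset) (auto simp: C1_def)
    have pair: "continuous_on C2 (\<lambda>x. (\<eta> x, \<theta> j x))"
      by (intro continuous_on_Pair continuous_on_subset[OF \<eta>(1)] continuous_on_subset[OF insert.prems(3)])
        (auto simp: C2_def)
    show "continuous_on C2 (\<lambda>x. \<H> j (\<eta> x, \<theta> j x))"
      by (rule continuous_on_compose2[OF insert.prems(1)[OF insertI1] pair])
        (use C2 in blast)
    fix x assume x: "x \<in> C1 \<and> \<theta> j x \<noteq> 0 \<or> x \<in> C2 \<and> \<theta> j x = 0"
    then have "x \<in> C2" "\<theta> j x = 0" by (auto simp: C1_def)
    then show "\<eta> x = \<H> j (\<eta> x, \<theta> j x)"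
      using Hj(1)[OF C2[of x]] by simp
  qed
  moreover have "dist (\<eta>' x) (\<gamma> x) \<le> \<theta> j x + (\<Sum>u\<in>I. \<theta> u x) \<and>
      g (\<eta>' x) \<le> g (\<gamma> x) - \<sigma> * (\<theta> j x + (\<Sum>u\<in>I. \<theta> u x))" if x: "x \<in> D" for x
  proof (cases "\<theta> j x = 0")
    case True
    then show ?thesis using \<eta>(2,3)[OF x] by (simp add: \<eta>'_def)
  next
    case False
    then have "\<eta>' x = \<H> j (\<eta> x, \<theta> j x)" by (simp add: \<eta>'_def)
    then show ?thesis
      using \<eta>(2,3)[OF x] Hj[OF C2[OF inC[OF x False]]]
        dist_triangle[of "\<eta>' x" "\<gamma> x" "\<eta> x"] by (simp add: algebra_simps)
  qed
  ultimately show ?case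
    unfolding ins D[symmetric] by blast
qed

text \<open>
  In the proof, \<open>R\<close> is the projection onto \<open>D\<close>; the condition \<open>F x = F (R x)\<close> identifies maps on \<open>D\<close>
  with bounded continuous functions on the whole space, so that uniform distances on \<open>D\<close> are
  distances in a complete metric type.
\<close>

lemma minimax_almost_critical_point:
  fixes g :: "'a::complete_space \<Rightarrow> real" and \<gamma> :: "'c::euclidean_space \<Rightarrow> 'a"
  assumes D: "compact D" "convex D" "D \<noteq> {}"
    and g: "continuous_on UNIV g" and \<gamma>: "continuous_on D \<gamma>" and "\<epsilon> > 0" "\<alpha> < c"
    and link: "\<And>\<phi>. continuous_on D \<phi> \<Longrightarrow> (\<And>x. x \<in> D \<Longrightarrow> g (\<gamma> x) \<le> \<alpha> \<Longrightarrow> \<phi> x = \<gamma> x) \<Longrightarrow>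
      \<exists>x\<in>D. c \<le> g (\<phi> x)"
    and up: "\<And>x. x \<in> D \<Longrightarrow> g (\<gamma> x) \<le> c + \<epsilon>\<^sup>2"
  obtains u x where "x \<in> D" "\<alpha> < g (\<gamma> x)" "dist (\<gamma> x) u \<le> \<epsilon>" "c \<le> g u" "g u \<le> c + \<epsilon>\<^sup>2"
    "weak_slope g u \<le> ennreal (2 * \<epsilon>)"
proof -
  define R where "R = closest_point D"
  have R: "continuous_on UNIV R" "R x \<in> D" for x
    unfolding R_def using D
    by (auto intro: continuous_on_closest_point closest_point_in_set compact_imp_closed)
  have RD: "R x = x" if "x \<in> D" for x
    unfolding R_def by (rule closest_point_self[OF that])
  have ext: "\<exists>F :: 'c \<Rightarrow>\<^sub>C 'a. \<forall>x. F x = \<phi> (R x)" if "continuous_on D \<phi>" for \<phi>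
  proof -
    have "continuous_on UNIV (\<lambda>x. \<phi> (R x))"
      using that R by (intro continuous_on_compose2[of D \<phi> UNIV R]) auto
    moreover have "range (\<lambda>x. \<phi> (R x)) \<subseteq> \<phi> ` D" using R by auto
    moreover have "bounded (\<phi> ` D)"
      using that D by (intro compact_imp_bounded compact_continuous_image)
    ultimately have "(\<lambda>x. \<phi> (R x)) \<in> bcontfun"
      unfolding bcontfun_def by (blast intro: bounded_subset)
    then show ?thesis by (metis bcontfunE)
  qed
  define A where "A = {F :: 'c \<Rightarrow>\<^sub>C 'a. (\<forall>x. F x = F (R x)) \<and> (\<forall>x\<in>D. g (\<gamma> x) \<le> \<alpha> \<longrightarrow> F x = \<gamma> x)}"
  have ptw: "(\<lambda>n. X n x) \<longlonglongrightarrow> F x" if "X \<longlonglongrightarrow> F" for X and F :: "'c \<Rightarrow>\<^sub>C 'a" and x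
    by (rule metric_tendsto_imp_tendsto[OF that]) (simp add: dist_bounded)
  have "closed A"
    unfolding closed_sequential_limits
  proof (intro allI impI)
    fix X F assume XF: "(\<forall>n. X n \<in> A) \<and> X \<longlonglongrightarrow> F"
    then have lim: "(\<lambda>n. X n x) \<longlonglongrightarrow> F x" for x using ptw by blast
    have "F x = F (R x)" for x
    proof (rule LIMSEQ_unique[OF lim[of x]])
      have "(\<lambda>n. X n (R x)) = (\<lambda>n. X n x)" using XF unfolding A_def by auto
      then show "(\<lambda>n. X n x) \<longlonglongrightarrow> F (R x)" using lim[of "R x"] by simp
    qed
    moreover have "F x = \<gamma> x" if "x \<in> D" "g (\<gamma> x) \<le> \<alpha>" for x
    proof (rule LIMSEQ_unique[OF lim[of x]])
      have "(\<lambda>n. X n x) = (\<lambda>n. \<gamma> x)" using XF that unfolding A_def by auto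
      then show "(\<lambda>n. X n x) \<longlonglongrightarrow> \<gamma> x" by simp
    qed
    ultimately show "F \<in> A" by (simp add: A_def)
  qed
  then have "complete A" by (simp add: complete_eq_closed)
  obtain F0 :: "'c \<Rightarrow>\<^sub>C 'a" where F0: "\<And>x. F0 x = \<gamma> (R x)" using ext[OF \<gamma>] by blast
  have "F0 \<in> A" using RD R by (simp add: A_def F0)
  define \<Phi> where "\<Phi> F = (SUP x\<in>D. g (apply_bcontfun F x))" for F
  have gF: "continuous_on D (\<lambda>x. g (apply_bcontfun F x))" for F
    using g by (rule continuous_on_compose2) auto
  have bdd: "bdd_above ((\<lambda>x. g (apply_bcontfun F x)) ` D)" for F
    using compact_continuous_image[OF gF D(1)] by (intro bounded_imp_bdd_above compact_imp_bounded)
  have \<Phi>_ge: "g (apply_bcontfun F x) \<le> \<Phi> F" if "x \<in> D" for F x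
    unfolding \<Phi>_def using that bdd by (rule cSUP_upper)
  have \<Phi>_le: "\<Phi> F \<le> a" if "\<And>x. x \<in> D \<Longrightarrow> g (apply_bcontfun F x) \<le> a" for F a
    unfolding \<Phi>_def using that D by (intro cSUP_least) auto
  have low: "c \<le> \<Phi> F" if "F \<in> A" for F
  proof -
    obtain x where "x \<in> D" "c \<le> g (F x)"
      using link[of "apply_bcontfun F"] \<open>F \<in> A\<close> by (auto simp: A_def)
    then show ?thesis using \<Phi>_ge[of x F] by linarith
  qed
  have lsc: "\<Phi> F \<le> a" if X: "\<And>n::nat. X n \<in> A \<and> \<Phi> (X n) \<le> a" and "X \<longlonglongrightarrow> F" for a X F
  proof (rule \<Phi>_le)
    fix x assume x: "x \<in> D"
    have "(\<lambda>n. g (X n x)) \<longlonglongrightarrow> g (F x)"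
      using g ptw[OF \<open>X \<longlonglongrightarrow> F\<close>] by (auto intro: continuous_on_tendsto_compose)
    then show "g (F x) \<le> a"
      by (rule LIMSEQ_le_const2) (use X \<Phi>_ge[OF x] in \<open>meson order_trans\<close>)
  qed
  obtain F where F: "F \<in> A" "\<Phi> F + \<epsilon> * dist F0 F \<le> \<Phi> F0"
    and Fmin: "\<And>G. G \<in> A \<Longrightarrow> G \<noteq> F \<Longrightarrow> \<Phi> F < \<Phi> G + \<epsilon> * dist F G"
    using ekeland[of A F0 c \<Phi> \<epsilon>] \<open>complete A\<close> \<open>F0 \<in> A\<close> low lsc \<open>\<epsilon> > 0\<close> by blast
  \<comment> \<open>\<Phi> at the start exceeds its lower bound \<open>c\<close> by at most
    \<open>\<epsilon>\<^sup>2\<close>, so Ekeland's point, found with slope \<epsilon>, is at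
    distance at most \<epsilon> from the start.\<close>
  have "\<Phi> F0 \<le> c + \<epsilon>\<^sup>2"
    using up R by (intro \<Phi>_le) (simp add: F0)
  moreover have "0 \<le> \<epsilon> * dist F0 F" using \<open>\<epsilon> > 0\<close> by simp
  ultimately have "\<epsilon> * dist F0 F \<le> \<epsilon> * \<epsilon>" and FP: "\<Phi> F \<le> c + \<epsilon>\<^sup>2"
    using F(2) low[OF F(1)] unfolding power2_eq_square by linarith+
  then have dF: "dist F0 F \<le> \<epsilon>"
    using \<open>\<epsilon> > 0\<close> by simp
  have F\<gamma>: "F x = \<gamma> x" if "x \<in> D" "g (\<gamma> x) \<le> \<alpha>" for x
    using F(1) that by (simp add: A_def)
  have top: "\<alpha> < g (F x)" if "x \<in> D" "c \<le> g (F x)" for x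
    using that \<open>\<alpha> < c\<close> by linarith
  show ?thesis
  proof (cases "\<exists>x\<in>D. c \<le> g (F x) \<and> weak_slope g (F x) \<le> ennreal (2 * \<epsilon>)")
    case True
    then obtain x where x: "x \<in> D" "c \<le> g (F x)" "weak_slope g (F x) \<le> ennreal (2 * \<epsilon>)"
      by blast
    show ?thesis
    proof (rule that[OF x(1) _ _ x(2) _ x(3)])
      \<comment> \<open>Localization: were \<open>g (\<gamma> x) \<le> \<alpha>\<close>, then
        \<open>F x\<close> would be pinned to \<open>\<gamma> x\<close>, contrary to
        \<open>g (F x) \<ge> c > \<alpha>\<close>.\<close>
      show "\<alpha> < g (\<gamma> x)" using F\<gamma>[OF x(1)] top[OF x(1,2)] by force
      show "dist (\<gamma> x) (F x) \<le> \<epsilon>"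
        using dist_bounded[of F0 x F] dF RD[OF x(1)] by (simp add: F0)
      show "g (F x) \<le> c + \<epsilon>\<^sup>2" using \<Phi>_ge[OF x(1)] FP by (rule order_trans)
    qed
  next
    case False
    \<comment> \<open>Now the slope exceeds \<open>2 * \<epsilon>\<close> at every maximum point of
      \<open>g\<close> along \<open>F\<close>. Pushing \<open>F\<close> down there gives a
      competitor \<open>G\<close> with \<open>dist F G \<le> s\<close> and
      \<open>\<Phi> G \<le> P - \<epsilon> * s\<close>, which Ekeland's strict inequality
      excludes.\<close>
    define P where "P = \<Phi> F"
    have gP: "g (F x) \<le> P" if "x \<in> D" for x using \<Phi>_ge[OF that] by (simp add: P_def)
    have Pc: "c \<le> P" using low[OF F(1)] by (simp add: P_def)
    define T where "T = {x \<in> D. g (F x) = P}"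
    have "T = D \<inter> (\<lambda>x. g (F x)) -` {P}" by (auto simp: T_def)
    then have "compact T"
      using D gF continuous_closedin_preimage[OF gF, of "{P}" F] closedin_compact by auto
    then have K: "compact (apply_bcontfun F ` T)"
      by (intro compact_continuous_image) auto
    have "\<exists>\<delta> \<H>. 0 < \<delta> \<and> continuous_on (ball v \<delta> \<times> {0..\<delta>}) \<H> \<and>
        (\<forall>w t. w \<in> ball v \<delta> \<longrightarrow> t \<in> {0..\<delta>} \<longrightarrow>
          dist (\<H> (w, t)) w \<le> t \<and> g (\<H> (w, t)) \<le> g w - 2 * \<epsilon> * t) \<and>
        (\<forall>w\<in>ball v \<delta>. \<alpha> < g w)" if v: "v \<in> apply_bcontfun F ` T" for v
    proof -
      have "ennreal (2 * \<epsilon>) < weak_slope g v" "\<alpha> < g v"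
        using v False Pc top by (force simp: T_def)+
      then obtain \<delta> \<H> where \<delta>: "\<delta> > 0" "continuous_on (ball v \<delta> \<times> {0..\<delta>}) \<H>"
        "\<And>w t. w \<in> ball v \<delta> \<Longrightarrow> t \<in> {0..\<delta>} \<Longrightarrow> dist (\<H> (w, t)) w \<le> t \<and> g (\<H> (w, t)) \<le> g w - 2 * \<epsilon> * t"
        using less_weak_slopeE[of "2 * \<epsilon>" g v] \<open>\<epsilon> > 0\<close> by (metis less_eq_real_def mult_pos_pos zero_less_numeral)
      \<comment> \<open>The balls are shrunk into the region where \<open>g\<close> exceeds
        \<alpha>, so that the push cannot touch the points where competitors are pinned to
        \<gamma>.\<close>
      have "open {w. \<alpha> < g w}"
        using g by (intro open_Collect_less) auto
      then obtain r where r: "r > 0" "ball v r \<subseteq> {w. \<alpha> < g w}"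
        using \<open>\<alpha> < g v\<close> open_contains_ball[of "{w. \<alpha> < g w}"] by blast
      have sub: "ball v (min \<delta> r) \<times> {0..min \<delta> r} \<subseteq> ball v \<delta> \<times> {0..\<delta>}" by auto
      show ?thesis
      proof (intro exI[of _ "min \<delta> r"] exI[of _ \<H>] conjI)
        show "continuous_on (ball v (min \<delta> r) \<times> {0..min \<delta> r}) \<H>"
          using \<delta>(2) sub by (rule continuous_on_subset)
        show "\<forall>w\<in>ball v (min \<delta> r). \<alpha> < g w" using r(2) by auto
      qed (use \<delta> r in auto)
    qed
    then obtain \<delta> \<H> where \<delta>: "\<And>v. v \<in> apply_bcontfun F ` T \<Longrightarrow> 0 < \<delta> v"
      and \<H>: "\<And>v. v \<in> apply_bcontfun F ` T \<Longrightarrow> continuous_on (ball v (\<delta> v) \<times> {0..\<delta> v}) (\<H> v)"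
      "\<And>v w t. v \<in> apply_bcontfun F ` T \<Longrightarrow> w \<in> ball v (\<delta> v) \<Longrightarrow> t \<in> {0..\<delta> v} \<Longrightarrow>
         dist (\<H> v (w, t)) w \<le> t \<and> g (\<H> v (w, t)) \<le> g w - 2 * \<epsilon> * t"
      and \<alpha>: "\<And>v w. v \<in> apply_bcontfun F ` T \<Longrightarrow> w \<in> ball v (\<delta> v) \<Longrightarrow> \<alpha> < g w"
      by metis
    obtain I where I: "I \<subseteq> apply_bcontfun F ` T" "finite I"
      "apply_bcontfun F ` T \<subseteq> (\<Union>v\<in>I. ball v (\<delta> v / 2))"
      by (rule compactE_image[OF K, of "apply_bcontfun F ` T" "\<lambda>v. ball v (\<delta> v / 2)"]) (use \<delta> in auto)
    \<comment> \<open>The tents \<open>\<phi> v\<close> live in the half balls. \<open>Z\<close> is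
      positive on \<open>D\<close>: at maximum points because of \<Sigma>, elsewhere because of
      \<open>P - g (F x)\<close>. Thus \<open>\<Sigma> x / Z x\<close> is a continuous cut-off, at
      most 1 and equal to 1 on \<open>T\<close>.\<close>
    define \<phi> where "\<phi> v x = max 0 (\<delta> v / 2 - dist v (F x))" for v x
    define \<Sigma> where "\<Sigma> x = (\<Sum>v\<in>I. \<phi> v x)" for x
    define Z where "Z x = (P - g (F x)) + \<Sigma> x" for x
    have \<phi>0: "0 \<le> \<phi> v x" for v x by (simp add: \<phi>_def)
    have \<Sigma>0: "0 \<le> \<Sigma> x" for x by (simp add: \<Sigma>_def sum_nonneg \<phi>0)
    have \<Sigma>pos: "0 < \<Sigma> x" if xT: "x \<in> T" for x
    proof -
      obtain v where "v \<in> I" "F x \<in> ball v (\<delta> v / 2)" using subsetD[OF I(3) imageI[OF xT]] by auto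
      then show ?thesis
        unfolding \<Sigma>_def by (intro sum_pos2[OF I(2) \<open>v \<in> I\<close> _ \<phi>0]) (simp add: \<phi>_def)
    qed
    have Zpos: "0 < Z x" if "x \<in> D" for x
    proof (cases "x \<in> T")
      case True
      then show ?thesis using \<Sigma>pos[OF True] by (simp add: Z_def T_def)
    next
      case False
      then have "g (F x) < P" using gP[OF that] that unfolding T_def by force
      then show ?thesis using \<Sigma>0[of x] by (simp add: Z_def)
    qed
    have cont: "continuous_on D (\<phi> v)" "continuous_on D \<Sigma>" "continuous_on D Z" for v
      unfolding \<phi>_def \<Sigma>_def Z_def using gF by (intro continuous_intros; simp)+
    \<comment> \<open>\<open>Q\<close> misses \<open>T\<close>, so by compactness
      \<open>g (F x)\<close> stays below \<open>P\<close> by some \<nu> on \<open>Q\<close>. Off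
      \<open>Q\<close> the push lasts at least \<open>s / 2\<close>, and rate
      \<open>2 * \<epsilon>\<close> lowers \<open>g\<close> by at least
      \<open>\<epsilon> * s\<close>; this is the origin of the factor 2 in the slope bound.\<close>
    define Q where "Q = D \<inter> (\<lambda>x. \<Sigma> x / Z x) -` {..1/2}"
    have "continuous_on D (\<lambda>x. \<Sigma> x / Z x)"
      using cont Zpos by (intro continuous_on_divide) force+
    then have "compact Q"
      unfolding Q_def using D continuous_closedin_preimage[of D _ "{..1/2::real}"] closedin_compact by blast
    have "\<exists>\<nu>>0. \<forall>x\<in>Q. g (F x) \<le> P - \<nu>"
    proof (cases "Q = {}")
      case False
      have "continuous_on Q (\<lambda>x. g (F x))" using gF by (rule continuous_on_subset) (auto simp: Q_def)
      then obtain y where y: "y \<in> Q" "\<And>x. x \<in> Q \<Longrightarrow> g (F x) \<le> g (F y)"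
        using continuous_attains_sup[OF \<open>compact Q\<close> False] by blast
      have "y \<notin> T"
      proof
        assume "y \<in> T"
        then have "Z y = \<Sigma> y" "0 < \<Sigma> y" using \<Sigma>pos by (auto simp: Z_def T_def)
        then show False using y(1) by (simp add: Q_def)
      qed
      then have "g (F y) < P" using y(1) gP[of y] by (force simp: Q_def T_def)
      then show ?thesis using y(2) by (intro exI[of _ "P - g (F y)"]) auto
    qed (auto intro: exI[of _ 1])
    then obtain \<nu> where \<nu>: "\<nu> > 0" "\<And>x. x \<in> Q \<Longrightarrow> g (F x) \<le> P - \<nu>" by blast
    \<comment> \<open>\<open>\<nu> / \<epsilon>\<close> ensures that on \<open>Q\<close> the margin
      \<nu> already covers \<open>\<epsilon> * s\<close>; \<open>\<delta> v / 4\<close> keeps the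
      total push below the half radii, as \<open>combine_deformations\<close> requires.\<close>
    define s where "s = Min (insert (\<nu> / \<epsilon>) ((\<lambda>v. \<delta> v / 4) ` I))"
    have s0: "s > 0" using \<nu> \<open>\<epsilon> > 0\<close> I \<delta> by (auto simp: s_def)
    have s\<nu>: "\<epsilon> * s \<le> \<nu>"
    proof -
      have "s \<le> \<nu> / \<epsilon>" unfolding s_def using I(2) by (intro Min_le) auto
      then show ?thesis using \<open>\<epsilon> > 0\<close> by (simp add: field_simps)
    qed
    have s\<delta>: "s < \<delta> v / 2" if "v \<in> I" for v
    proof -
      have "s \<le> \<delta> v / 4" unfolding s_def using I(2) that by (intro Min_le) auto
      moreover have "\<delta> v > 0" using \<delta> I(1) that by blast
      ultimately show ?thesis by linarith
    qed
    define \<theta> where "\<theta> v x = s * \<phi> v x / Z x" for v x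
    have \<theta>sum: "(\<Sum>v\<in>I. \<theta> v x) = s * (\<Sigma> x / Z x)" for x
      by (simp add: \<theta>_def \<Sigma>_def sum_distrib_left sum_divide_distrib)
    have frac: "\<Sigma> x / Z x \<le> 1" if "x \<in> D" for x
      using Zpos[OF that] gP[OF that] by (simp add: Z_def)
    have s\<Sigma>: "s * (\<Sigma> x / Z x) \<le> s" if "x \<in> D" for x
      using mult_left_mono[OF frac[OF that] less_imp_le[OF s0]] by (simp only: mult_1_right)
    have \<theta>le: "(\<Sum>v\<in>I. \<theta> v x) \<le> s" if "x \<in> D" for x
      unfolding \<theta>sum using s\<Sigma>[OF that] .
    have supp: "dist v (F x) < \<delta> v / 2" if "x \<in> D" "0 < \<theta> v x" for v x
    proof (rule ccontr)
      assume "\<not> ?thesis"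
      then have "\<phi> v x = 0" by (simp add: \<phi>_def)
      then show False using that by (simp add: \<theta>_def)
    qed
    have "\<exists>\<eta>. continuous_on D \<eta> \<and> (\<forall>x\<in>D. dist (\<eta> x) (F x) \<le> (\<Sum>v\<in>I. \<theta> v x) \<and>
      g (\<eta> x) \<le> g (F x) - 2 * \<epsilon> * (\<Sum>v\<in>I. \<theta> v x))"
    proof (rule combine_deformations[OF I(2), where \<delta> = \<delta> and \<H> = \<H> and b = s])
      show "continuous_on D (\<theta> v)" for v
        unfolding \<theta>_def using cont Zpos by (intro continuous_intros) force+
      show "0 \<le> \<theta> v x" if "x \<in> D" for v x
        unfolding \<theta>_def using s0 \<phi>0 Zpos[OF that] by simp
    qed (use \<H> I(1) supp \<theta>le s\<delta> in \<open>simp_all add: subset_iff\<close>)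
    then obtain \<eta> where \<eta>: "continuous_on D \<eta>"
      "\<And>x. x \<in> D \<Longrightarrow> dist (\<eta> x) (F x) \<le> s * (\<Sigma> x / Z x)"
      "\<And>x. x \<in> D \<Longrightarrow> g (\<eta> x) \<le> g (F x) - 2 * \<epsilon> * (s * (\<Sigma> x / Z x))"
      unfolding \<theta>sum by blast
    obtain G :: "'c \<Rightarrow>\<^sub>C 'a" where G: "\<And>x. G x = \<eta> (R x)" using ext[OF \<eta>(1)] by blast
    have "G \<in> A"
    proof -
      \<comment> \<open>At a pinned point \<open>F x = \<gamma> x\<close> has value at most \<alpha>
        and so lies outside all the balls: every tent vanishes, the push time is 0 and the point
        stays fixed.\<close>
      have "\<eta> x = \<gamma> x" if x: "x \<in> D" "g (\<gamma> x) \<le> \<alpha>" for x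
      proof -
        have "\<phi> v x = 0" if v: "v \<in> I" for v
        proof (rule ccontr)
          assume "\<phi> v x \<noteq> 0"
          then have "F x \<in> ball v (\<delta> v)"
            by (auto simp: \<phi>_def max_def split: if_splits) (smt (verit) zero_le_dist)
          then have "\<alpha> < g (F x)" using \<alpha>[of v "F x"] v I(1) by blast
          then show False using F\<gamma>[OF x] x(2) by simp
        qed
        then have "\<Sigma> x = 0" by (simp add: \<Sigma>_def)
        then show ?thesis using \<eta>(2)[OF x(1)] F\<gamma>[OF x] by simp
      qed
      then show ?thesis by (simp add: A_def G R RD)
    qed
    have "\<Phi> G \<le> P - \<epsilon> * s"
    proof (rule \<Phi>_le)
      fix x assume x: "x \<in> D"
      have Gx: "G x = \<eta> x" using RD[OF x] by (simp add: G)
      have nonneg: "0 \<le> \<Sigma> x / Z x" using \<Sigma>0[of x] Zpos[OF x] by simp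
      show "g (G x) \<le> P - \<epsilon> * s"
      proof (cases "x \<in> Q")
        case True
        have "0 \<le> 2 * \<epsilon> * (s * (\<Sigma> x / Z x))"
          using nonneg s0 \<open>\<epsilon> > 0\<close> by (intro mult_nonneg_nonneg) auto
        then show ?thesis
          using \<eta>(3)[OF x] \<nu>(2)[OF True] s\<nu> unfolding Gx by linarith
      next
        case False
        then have "1 / 2 \<le> \<Sigma> x / Z x" using x by (simp add: Q_def)
        then have "2 * \<epsilon> * s * (1/2) \<le> 2 * \<epsilon> * s * (\<Sigma> x / Z x)"
          using s0 \<open>\<epsilon> > 0\<close> by (intro mult_left_mono) auto
        then show ?thesis
          using \<eta>(3)[OF x] gP[OF x] unfolding Gx by (simp add: mult.assoc)
      qed
    qed
    moreover have "dist F G \<le> s"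
    proof (rule dist_bound)
      fix x
      have "F x = F (R x)" using F(1) by (simp add: A_def)
      then have "dist (F x) (G x) \<le> s * (\<Sigma> (R x) / Z (R x))"
        using \<eta>(2)[OF R(2)[of x]] by (simp add: G dist_commute)
      also have "\<dots> \<le> s" using s\<Sigma>[OF R(2)] .
      finally show "dist (F x) (G x) \<le> s" .
    qed
    moreover have "G \<noteq> F"
      using \<open>\<Phi> G \<le> P - \<epsilon> * s\<close> mult_pos_pos[OF \<open>\<epsilon> > 0\<close> s0] by (auto simp: P_def)
    ultimately have "P < P - \<epsilon> * s + \<epsilon> * s"
      using Fmin[OF \<open>G \<in> A\<close>] \<open>\<epsilon> > 0\<close> mult_left_mono[of "dist F G" s \<epsilon>] unfolding P_def by linarith
    then show ?thesis by simp
  qed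
qed

subsection \<open>Polarization of maps\<close>

context symmetrization_framework
begin

lemma foldl_pol_in: "u \<in> S \<Longrightarrow> set hs \<subseteq> Hs \<Longrightarrow> foldl pol u hs \<in> S"
  by (induction hs arbitrary: u) (auto simp: pol_in)

lemma symm_foldl_pol: "u \<in> S \<Longrightarrow> set hs \<subseteq> Hs \<Longrightarrow> symm (foldl pol u hs) = symm u"
  by (induction hs arbitrary: u) (auto simp: pol_in symm_pol)

lemma foldl_pol_nonexpansive:
  "u \<in> S \<Longrightarrow> v \<in> S \<Longrightarrow> set hs \<subseteq> Hs \<Longrightarrow>
    norm (emb (foldl pol u hs) - emb (foldl pol v hs)) \<le> norm (emb u - emb v)"
proof (induction hs arbitrary: u v)
  case (Cons h hs)
  then have "norm (emb (foldl pol (pol u h) hs) - emb (foldl pol (pol v h) hs))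
      \<le> norm (emb (pol u h) - emb (pol v h))"
    by (simp add: pol_in)
  also have "\<dots> \<le> norm (emb u - emb v)"
    using Cons.prems by (simp add: pol_nonexpansive)
  finally show ?case by simp
qed simp

lemma foldl_pol_constant:
  assumes "u \<in> S" "H \<in> Hs"
  shows "foldl pol u (map (\<lambda>_. H) [0..<Suc m]) = pol u H"
  using assms by (induction m) (simp_all add: pol_idem)

lemma foldl_pol_decreases:
  assumes "\<And>H u. H \<in> Hs \<Longrightarrow> u \<in> S \<Longrightarrow> g (pol u H) \<le> (g u :: real)"
    and "u \<in> S" "set hs \<subseteq> Hs"
  shows "g (foldl pol u hs) \<le> g u"
  using assms(2,3)
proof (induction hs arbitrary: u)
  case (Cons h hs)
  then have "g (foldl pol (pol u h) hs) \<le> g (pol u h)"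
    by (simp add: pol_in)
  also have "\<dots> \<le> g u"
    using Cons.prems assms(1) by simp
  finally show ?case by simp
qed simp

text \<open>One polarizer sequence serves all of \<open>S\<close>, so the contraction estimate for
  iterated polarizations passes to the limit.\<close>

lemma symm_nonexpansive:
  assumes "u \<in> S" "v \<in> S"
  shows "norm (emb (symm u) - emb (symm v)) \<le> norm (emb u - emb v)"
proof -
  obtain H :: "nat \<Rightarrow> 'h" where H: "range H \<subseteq> Hs"
    "\<And>u. u \<in> S \<Longrightarrow> (\<lambda>m. emb (foldl pol u (map H [0..<m]))) \<longlonglongrightarrow> emb (symm u)"
    using approx_symm by blast
  have "(\<lambda>m. norm (emb (foldl pol u (map H [0..<m])) - emb (foldl pol v (map H [0..<m]))))
      \<longlonglongrightarrow> norm (emb (symm u) - emb (symm v))"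
    using H(2) assms by (intro tendsto_intros)
  moreover have "norm (emb (foldl pol u (map H [0..<m])) - emb (foldl pol v (map H [0..<m])))
      \<le> norm (emb u - emb v)" for m
    using H(1) assms by (intro foldl_pol_nonexpansive) auto
  ultimately show ?thesis
    by (intro LIMSEQ_le_const2) auto
qed

lemma symm_ext_lipschitz:
  obtains L where "L \<ge> 0"
    "\<And>u v. norm (emb (symm_ext symm \<Theta> u) - emb (symm_ext symm \<Theta> v)) \<le> L * norm (emb u - emb v)"
proof -
  obtain L where L: "\<And>u v. norm (emb (\<Theta> u) - emb (\<Theta> v)) \<le> L * norm (emb u - emb v)"
    using Theta_lipschitz by blast
  have "norm (emb (symm_ext symm \<Theta> u) - emb (symm_ext symm \<Theta> v)) \<le> \<bar>L\<bar> * norm (emb u - emb v)" for u v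
  proof -
    have "norm (emb (symm (\<Theta> u)) - emb (symm (\<Theta> v))) \<le> norm (emb (\<Theta> u) - emb (\<Theta> v))"
      by (intro symm_nonexpansive Theta_in)
    also have "\<dots> \<le> L * norm (emb u - emb v)" by (rule L)
    also have "\<dots> \<le> \<bar>L\<bar> * norm (emb u - emb v)" by (intro mult_right_mono) auto
    finally show ?thesis by (simp add: symm_ext_def)
  qed
  then show ?thesis using that[of "\<bar>L\<bar>"] by simp
qed

text \<open>Pointwise convergence of maps with a common Lipschitz constant is uniform on compact
  sets: compare with a finite net of mesh \<open>\<epsilon> / 3\<close> in the norm of the target
  space of \<open>emb\<close>.\<close>

lemma uniform_approx_symm:
  assumes H: "range H \<subseteq> Hs"
    "\<And>u. u \<in> S \<Longrightarrow> (\<lambda>m. emb (foldl pol u (map H [0..<m]))) \<longlonglongrightarrow> emb (symm u)"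
    and K: "compact K" "K \<subseteq> S" and "\<epsilon> > 0"
  shows "\<forall>\<^sub>F m in sequentially. \<forall>u\<in>K. norm (emb (foldl pol u (map H [0..<m])) - emb (symm u)) \<le> \<epsilon>"
proof -
  have "compact (emb ` K)"
    using K(1) emb_bounded_linear
    by (intro compact_continuous_image) (auto intro: bounded_linear.continuous_on continuous_on_id)
  then obtain F where F: "F \<subseteq> K" "finite F" "emb ` K \<subseteq> (\<Union>w\<in>F. ball (emb w) (\<epsilon> / 3))"
    by (rule compactE_image[of _ K "\<lambda>w. ball (emb w) (\<epsilon> / 3)"]) (use \<open>\<epsilon> > 0\<close> in auto)
  have "\<forall>\<^sub>F m in sequentially. \<forall>w\<in>F. norm (emb (foldl pol w (map H [0..<m])) - emb (symm w)) < \<epsilon> / 3"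
  proof (intro eventually_ball_finite F(2) ballI)
    fix w assume "w \<in> F"
    then have "w \<in> S" using F(1) K(2) by blast
    then show "\<forall>\<^sub>F m in sequentially. norm (emb (foldl pol w (map H [0..<m])) - emb (symm w)) < \<epsilon> / 3"
      using tendstoD[OF H(2), of w "\<epsilon> / 3"] \<open>\<epsilon> > 0\<close> by (simp add: dist_norm)
  qed
  then show ?thesis
  proof (rule eventually_mono, intro ballI)
    fix m u assume m: "\<forall>w\<in>F. norm (emb (foldl pol w (map H [0..<m])) - emb (symm w)) < \<epsilon> / 3" and u: "u \<in> K"
    let ?p = "\<lambda>u. emb (foldl pol u (map H [0..<m]))"
    have "emb u \<in> (\<Union>w\<in>F. ball (emb w) (\<epsilon> / 3))" using F(3) u by blast
    then obtain w where w: "w \<in> F" "dist (emb w) (emb u) < \<epsilon> / 3" by auto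
    have inS: "u \<in> S" "w \<in> S" using u w F(1) K(2) by auto
    have "norm (?p u - ?p w) \<le> norm (emb u - emb w)"
      using inS H(1) by (intro foldl_pol_nonexpansive) auto
    moreover have "norm (emb (symm w) - emb (symm u)) \<le> norm (emb w - emb u)"
      using inS by (intro symm_nonexpansive)
    moreover have "norm (?p w - emb (symm w)) < \<epsilon> / 3" using m w(1) by blast
    moreover have "norm (?p u - emb (symm u)) \<le> norm (?p u - ?p w) + norm (?p w - emb (symm w))
        + norm (emb (symm w) - emb (symm u))"
      using norm_triangle_ineq[of "?p u - ?p w" "?p w - emb (symm w)"]
        norm_triangle_ineq[of "?p u - emb (symm w)" "emb (symm w) - emb (symm u)"] by simp
    ultimately show "norm (?p u - emb (symm u)) \<le> \<epsilon>"
      using w(2) by (simp add: dist_norm norm_minus_commute)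
  qed
qed

text \<open>The polarizers may vary with the point, which is where joint continuity of
  \<open>pol\<close> enters.\<close>

lemma continuous_on_foldl_pol:
  fixes p :: "nat \<Rightarrow> 'c::topological_space \<Rightarrow> 'h"
  assumes "continuous_on D \<gamma>" "\<gamma> ` D \<subseteq> S"
    and "\<And>i. continuous_on D (p i)" "\<And>i x. x \<in> D \<Longrightarrow> p i x \<in> Hs"
  shows "continuous_on D (\<lambda>x. foldl pol (\<gamma> x) (map (\<lambda>i. p i x) [0..<m]))"
proof (induction m)
  case (Suc m)
  have "continuous_on D (\<lambda>x. case (foldl pol (\<gamma> x) (map (\<lambda>i. p i x) [0..<m]), p m x) of (u, H) \<Rightarrow> pol u H)"
    by (rule continuous_on_compose2[OF pol_continuous continuous_on_Pair[OF Suc assms(3)]])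
      (use assms in \<open>auto intro!: foldl_pol_in\<close>)
  then show ?case by simp
qed (use assms in simp)

text \<open>
  Each polarizer is joined to \<open>H0\<close> by a path in \<open>Hs\<close>, run as a function of the value of \<open>g\<close>:
  where \<open>g \<ge> \<alpha>\<close> all the polarizers of the approximating sequence are applied, while on \<open>E\<close>
  all of them have become \<open>H0\<close> and by idempotence act as \<open>H0\<close> alone.
\<close>

lemma polarized_map:
  fixes \<gamma> :: "'c::topological_space \<Rightarrow> 'a" and g :: "'a \<Rightarrow> real"
  assumes D: "compact D" and \<gamma>: "continuous_on D \<gamma>" "\<gamma> ` D \<subseteq> S"
    and g: "continuous_on UNIV g" and "H0 \<in> Hs"
    and E: "E \<subseteq> D" "\<And>x. x \<in> E \<Longrightarrow> g (\<gamma> x) \<le> a" and "a < \<alpha>" "\<epsilon> > 0"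
    and dec: "\<And>H u. H \<in> Hs \<Longrightarrow> u \<in> S \<Longrightarrow> g (pol u H) \<le> g u"
  obtains \<phi> where "continuous_on D \<phi>" "\<phi> ` D \<subseteq> S" "\<And>x. x \<in> E \<Longrightarrow> \<phi> x = pol (\<gamma> x) H0"
    "\<And>x k :: 'a \<Rightarrow> real. x \<in> D \<Longrightarrow> (\<And>H u. H \<in> Hs \<Longrightarrow> u \<in> S \<Longrightarrow> k (pol u H) \<le> k u) \<Longrightarrow> k (\<phi> x) \<le> k (\<gamma> x)"
    "\<And>x. x \<in> D \<Longrightarrow> \<alpha> \<le> g (\<phi> x) \<Longrightarrow> norm (emb (\<phi> x) - emb (symm (\<phi> x))) \<le> \<epsilon>"
proof -
  obtain H :: "nat \<Rightarrow> 'h" where H: "range H \<subseteq> Hs"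
    "\<And>u. u \<in> S \<Longrightarrow> (\<lambda>m. emb (foldl pol u (map H [0..<m]))) \<longlonglongrightarrow> emb (symm u)"
    using approx_symm by blast
  have "compact (\<gamma> ` D)" using D \<gamma>(1) by (rule compact_continuous_image[rotated])
  then have "\<forall>\<^sub>F m in sequentially. \<forall>u\<in>\<gamma> ` D.
      norm (emb (foldl pol u (map H [0..<m])) - emb (symm u)) \<le> \<epsilon>"
    using uniform_approx_symm[OF H _ \<gamma>(2) \<open>\<epsilon> > 0\<close>] by blast
  then obtain m0 where m0: "\<And>m u. m \<ge> m0 \<Longrightarrow> u \<in> \<gamma> ` D \<Longrightarrow>
      norm (emb (foldl pol u (map H [0..<m])) - emb (symm u)) \<le> \<epsilon>"
    by (auto simp: eventually_sequentially)
  have "\<exists>q. path q \<and> path_image q \<subseteq> Hs \<and> pathstart q = H i \<and> pathfinish q = H0" for i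
    using Hs_path_connected H(1) \<open>H0 \<in> Hs\<close> unfolding path_connected_def by blast
  then obtain q where q: "\<And>i. path (q i)" "\<And>i. path_image (q i) \<subseteq> Hs"
    "\<And>i. q i 0 = H i" "\<And>i. q i 1 = H0"
    unfolding pathstart_def pathfinish_def by metis
  \<comment> \<open>The path parameter: 0 where \<open>g (\<gamma> x) \<ge> \<alpha>\<close>, 1
    where \<open>g (\<gamma> x) \<le> a\<close>, affine in the value of \<open>g\<close>
    between.\<close>
  define s where "s x = min 1 (max 0 ((\<alpha> - g (\<gamma> x)) / (\<alpha> - a)))" for x
  have s: "continuous_on D s"
    unfolding s_def using \<open>a < \<alpha>\<close> continuous_on_compose2[OF g \<gamma>(1)] by (intro continuous_intros) auto
  have s01: "s x \<in> {0..1}" for x by (simp add: s_def)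
  define p where "p i x = q i (s x)" for i x
  have p: "p i x \<in> Hs" "continuous_on D (p i)" for i x
  proof -
    show "p i x \<in> Hs"
      unfolding p_def using q(2)[of i] s01[of x] unfolding path_image_def by blast
    show "continuous_on D (p i)"
      unfolding p_def
      by (rule continuous_on_compose2[OF q(1)[of i, unfolded path_def] s]) (use s01 in auto)
  qed
  \<comment> \<open>\<open>Suc m0\<close> instead of \<open>m0\<close>: at least one polarization
    must be performed for the fold to equal \<open>pol (\<gamma> x) H0\<close> on
    \<open>E\<close>.\<close>
  define \<phi> where "\<phi> x = foldl pol (\<gamma> x) (map (\<lambda>i. p i x) [0..<Suc m0])" for x
  have pH: "set (map (\<lambda>i. p i x) [0..<Suc m0]) \<subseteq> Hs" for x using p by auto
  have inS: "\<gamma> x \<in> S" if "x \<in> D" for x using that \<gamma>(2) by blast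
  show ?thesis
  proof (rule that)
    show "continuous_on D \<phi>"
      unfolding \<phi>_def by (rule continuous_on_foldl_pol) (use \<gamma> p in auto)
    show "\<phi> ` D \<subseteq> S"
      unfolding \<phi>_def using inS foldl_pol_in pH by blast
    show "\<phi> x = pol (\<gamma> x) H0" if x: "x \<in> E" for x
    proof -
      have "1 \<le> (\<alpha> - g (\<gamma> x)) / (\<alpha> - a)" using E(2)[OF x] \<open>a < \<alpha>\<close> by (simp add: field_simps)
      then have "s x = 1" by (simp add: s_def)
      then have "p i x = H0" for i by (simp add: p_def q)
      then show ?thesis
        unfolding \<phi>_def using foldl_pol_constant[of "\<gamma> x" H0 m0] inS x E(1) \<open>H0 \<in> Hs\<close> by auto
    qed
    \<comment> \<open>A general \<open>k\<close> is allowed because the cut-off will be built from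
      \<open>f l\<close> while the energy estimate concerns \<open>f (ls h)\<close>.\<close>
    show le: "k (\<phi> x) \<le> k (\<gamma> x)"
      if "x \<in> D" "\<And>H u. H \<in> Hs \<Longrightarrow> u \<in> S \<Longrightarrow> k (pol u H) \<le> k u" for x and k :: "'a \<Rightarrow> real"
      unfolding \<phi>_def by (rule foldl_pol_decreases) (use that inS pH in auto)
    show "norm (emb (\<phi> x) - emb (symm (\<phi> x))) \<le> \<epsilon>" if x: "x \<in> D" "\<alpha> \<le> g (\<phi> x)" for x
    proof -
      \<comment> \<open>Polarization does not raise \<open>g\<close>, so a high value of
        \<open>\<phi> x\<close> forces a high value of \<open>\<gamma> x\<close>; there the
        polarizers are exactly those of the approximating sequence. They leave the symmetrization
        unchanged.\<close>
      have "\<alpha> \<le> g (\<gamma> x)" using le[of x g, OF x(1) dec] x(2) by simp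
      then have "(\<alpha> - g (\<gamma> x)) / (\<alpha> - a) \<le> 0" using \<open>a < \<alpha>\<close> by (simp add: divide_nonpos_pos)
      then have "s x = 0" by (simp add: s_def)
      then have "\<phi> x = foldl pol (\<gamma> x) (map H [0..<Suc m0])" by (simp add: \<phi>_def p_def q)
      moreover have "symm (\<phi> x) = symm (\<gamma> x)"
        unfolding \<phi>_def by (rule symm_foldl_pol) (use inS[OF x(1)] pH in auto)
      ultimately show ?thesis using m0[of "Suc m0" "\<gamma> x"] x(1) by simp
    qed
  qed
qed

end

subsection \<open>The monotonicity trick\<close>

text \<open>\<open>cc\<close> plays the minimax level and enters only through \<open>cc_le\<close>,
  \<open>cc_approx\<close>, \<open>gap\<close> and \<open>quot\<close>. The quotient bound turns
  near-optimality at \<open>ls h\<close> into an estimate by \<open>cc l\<close> with error of order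
  \<open>l - ls h\<close>, exactly what \<open>bounds\<close> can use; \<open>gap\<close> keeps the
  threshold \<open>cc l - (l - ls h)\<close> above the boundary values.\<close>

lemma (in symmetrization_framework) SBPS_sequence_at_parameter:
  fixes f :: "real \<Rightarrow> 'a \<Rightarrow> real" and \<Gamma>0 :: "(real ^ 'm \<Rightarrow> 'a) set" and cc :: "real \<Rightarrow> real"
  assumes f_cont: "\<And>k. k \<in> \<Lambda> \<Longrightarrow> continuous_on UNIV (f k)"
    and bounds: "\<And>C ls (u :: nat \<Rightarrow> 'a) l. range ls \<subseteq> \<Lambda> \<Longrightarrow> strict_mono ls \<Longrightarrow> ls \<longlonglongrightarrow> l \<Longrightarrow>
      (\<And>h. f (ls h) (u h) \<le> C \<and> - f l (u h) \<le> C \<and> (f (ls h) (u h) - f l (u h)) / (l - ls h) \<le> C) \<Longrightarrow>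
      (\<forall>h. norm (u h) \<le> B C) \<and> (\<forall>\<epsilon>>0. \<forall>\<^sub>F h in sequentially. f l (u h) \<le> f (ls h) (u h) + \<epsilon>)"
    and symmetrize: "\<And>\<gamma>. \<gamma> \<in> admissible_maps \<Gamma>0 \<Longrightarrow>
      \<exists>\<gamma>'\<in>admissible_maps \<Gamma>0. \<exists>H0\<in>Hs.
        \<gamma>' ` cball 0 1 \<subseteq> S \<and>
        restrict (\<lambda>\<tau>. pol (\<gamma>' \<tau>) H0) (sphere 0 1) \<in> \<Gamma>0 \<and>
        (\<forall>t\<in>cball 0 1. \<forall>l\<in>\<Lambda>. f l (\<gamma>' t) \<le> f l (\<gamma> t))"
    and pol_decreases: "\<And>l H u. l \<in> \<Lambda> \<Longrightarrow> H \<in> Hs \<Longrightarrow> u \<in> S \<Longrightarrow> f l (pol u H) \<le> f l u"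
    and cc_le: "\<And>\<gamma>. \<gamma> \<in> admissible_maps \<Gamma>0 \<Longrightarrow> \<exists>t\<in>cball 0 1. cc l \<le> f l (\<gamma> t)"
    and cc_approx: "\<And>k e. k \<in> \<Lambda> \<Longrightarrow> e > 0 \<Longrightarrow>
      \<exists>\<gamma>\<in>admissible_maps \<Gamma>0. \<forall>t\<in>cball 0 1. f k (\<gamma> t) \<le> cc k + e"
    and bdry: "\<And>\<gamma> \<tau>. \<gamma> \<in> \<Gamma>0 \<Longrightarrow> \<tau> \<in> sphere 0 1 \<Longrightarrow> f l (\<gamma> \<tau>) \<le> a"
    and l: "l \<in> \<Lambda>" and ls: "range ls \<subseteq> \<Lambda>" "strict_mono ls" "ls \<longlonglongrightarrow> l" "\<And>h. ls h < l"
    and gap: "\<And>h. a < cc l - (l - ls h)"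
    and quot: "\<And>h. cc (ls h) - cc l \<le> M * (l - ls h)"
  shows "\<exists>u. SBPS_sequence emb (symm_ext symm \<Theta>) (f l) (cc l) u"
proof -
  let ?D = "cball 0 1 :: (real ^ 'm) set"
  define d where "d h = l - ls h" for h
  have d0: "d h > 0" for h using ls(4) by (simp add: d_def)
  have d_le: "d h \<le> d 0" for h
    using strict_mono_less_eq[OF ls(2), of 0 h] by (simp add: d_def)
  have d_lim: "d \<longlonglongrightarrow> 0"
    unfolding d_def using tendsto_diff[OF tendsto_const[of l] ls(3)] by simp
  have lsL: "ls h \<in> \<Lambda>" for h using ls(1) by blast
  have "\<exists>\<gamma>\<in>admissible_maps \<Gamma>0. \<gamma> ` ?D \<subseteq> S \<and> (\<forall>t\<in>?D. f (ls h) (\<gamma> t) \<le> cc (ls h) + d h) \<and>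
     (\<forall>t\<in>?D. cc l - d h \<le> f l (\<gamma> t) \<longrightarrow> norm (emb (\<gamma> t) - emb (symm (\<gamma> t))) \<le> d h)" for h
  proof -
    obtain \<gamma>1 where \<gamma>1: "\<gamma>1 \<in> admissible_maps \<Gamma>0" "\<And>t. t \<in> ?D \<Longrightarrow> f (ls h) (\<gamma>1 t) \<le> cc (ls h) + d h"
      using cc_approx[OF lsL d0] by blast
    obtain \<gamma>2 H0 where \<gamma>2: "\<gamma>2 \<in> admissible_maps \<Gamma>0" "H0 \<in> Hs" "\<gamma>2 ` ?D \<subseteq> S"
      "restrict (\<lambda>\<tau>. pol (\<gamma>2 \<tau>) H0) (sphere 0 1) \<in> \<Gamma>0"
      "\<And>t. t \<in> ?D \<Longrightarrow> f (ls h) (\<gamma>2 t) \<le> f (ls h) (\<gamma>1 t)"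
      using symmetrize[OF \<gamma>1(1)] lsL by meson
    have c2: "continuous_on ?D \<gamma>2" and b2: "restrict \<gamma>2 (sphere 0 1) \<in> \<Gamma>0"
      using \<gamma>2(1) by (auto simp: admissible_maps_def cont_maps_def)
    have sph: "f l (\<gamma>2 x) \<le> a" if "x \<in> sphere 0 1" for x
      using bdry[OF b2 that] that by simp
    have "a < cc l - d h" using gap[of h] by (simp add: d_def)
    obtain \<phi> where \<phi>: "continuous_on ?D \<phi>" "\<phi> ` ?D \<subseteq> S" "\<And>x. x \<in> sphere 0 1 \<Longrightarrow> \<phi> x = pol (\<gamma>2 x) H0"
      "\<And>x k. x \<in> ?D \<Longrightarrow> (\<And>H u. H \<in> Hs \<Longrightarrow> u \<in> S \<Longrightarrow> k (pol u H) \<le> (k u :: real)) \<Longrightarrow> k (\<phi> x) \<le> k (\<gamma>2 x)"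
      "\<And>x. x \<in> ?D \<Longrightarrow> cc l - d h \<le> f l (\<phi> x) \<Longrightarrow> norm (emb (\<phi> x) - emb (symm (\<phi> x))) \<le> d h"
      by (rule polarized_map[OF compact_cball c2 \<gamma>2(3) f_cont[OF l] \<gamma>2(2) sphere_cball sph
            \<open>a < cc l - d h\<close> d0[of h] pol_decreases[OF l]]) blast+
    define \<gamma> where "\<gamma> = restrict \<phi> ?D"
    have \<gamma>D: "\<gamma> t = \<phi> t" if "t \<in> ?D" for t using that by (simp add: \<gamma>_def)
    \<comment> \<open>On the sphere \<open>f l\<close> is at most \<open>a\<close>, so only
      \<open>H0\<close> acts there, and \<open>symmetrize\<close> places this polarized boundary map
      in \<open>\<Gamma>0\<close>.\<close>
    have "restrict \<gamma> (sphere 0 1) = restrict (\<lambda>\<tau>. pol (\<gamma>2 \<tau>) H0) (sphere 0 1)"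
      by (rule restrict_ext) (use \<phi>(3) in \<open>simp add: \<gamma>_def\<close>)
    moreover have "continuous_on ?D \<gamma>"
      using \<phi>(1) by (rule continuous_on_eq) (simp add: \<gamma>D)
    ultimately have "\<gamma> \<in> admissible_maps \<Gamma>0"
      using \<gamma>2(4) by (simp add: admissible_maps_def cont_maps_def \<gamma>_def)
    moreover have "\<gamma> ` ?D \<subseteq> S" using \<phi>(2) \<gamma>D by auto
    moreover have "f (ls h) (\<gamma> t) \<le> cc (ls h) + d h" if t: "t \<in> ?D" for t
    proof -
      have "f (ls h) (\<phi> t) \<le> f (ls h) (\<gamma>2 t)"
        by (rule \<phi>(4)[OF t]) (rule pol_decreases[OF lsL])
      then show ?thesis
        using \<gamma>2(5)[OF t] \<gamma>1(2)[OF t] unfolding \<gamma>D[OF t] by linarith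
    qed
    ultimately show ?thesis
      using \<phi>(5) \<gamma>D by (intro bexI[of _ \<gamma>]) auto
  qed
  then obtain \<gamma> where \<gamma>: "\<And>h. \<gamma> h \<in> admissible_maps \<Gamma>0" "\<And>h. \<gamma> h ` ?D \<subseteq> S"
     "\<And>h t. t \<in> ?D \<Longrightarrow> f (ls h) (\<gamma> h t) \<le> cc (ls h) + d h"
     "\<And>h t. t \<in> ?D \<Longrightarrow> cc l - d h \<le> f l (\<gamma> h t) \<Longrightarrow> norm (emb (\<gamma> h t) - emb (symm (\<gamma> h t))) \<le> d h"
    by metis
  have \<gamma>c: "continuous_on ?D (\<gamma> h)" for h
    using \<gamma>(1)[of h] by (auto simp: admissible_maps_def cont_maps_def)
  have up: "f (ls h) (\<gamma> h t) \<le> cc l + (M + 1) * d h" if "t \<in> ?D" for h t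
    using \<gamma>(3)[OF that, of h] quot[of h] by (simp add: d_def algebra_simps)
  \<comment> \<open>The three entries bound the three quantities in \<open>bounds\<close>, in order,
    using \<open>d h \<le> d 0\<close>; \<open>M + 1\<close> may be negative, hence the absolute
    value. The last one is \<open>(M + 1) * d h\<close> from above plus \<open>d h\<close> from
    below, divided by \<open>d h\<close>.\<close>
  define C where "C = max (cc l + \<bar>M + 1\<bar> * d 0) (max (d 0 - cc l) (M + 2))"
  have sel: "(\<forall>h. norm (\<gamma> h (\<tau> h)) \<le> B C) \<and>
      (\<forall>\<epsilon>>0. \<forall>\<^sub>F h in sequentially. f l (\<gamma> h (\<tau> h)) \<le> f (ls h) (\<gamma> h (\<tau> h)) + \<epsilon>)"
    if \<tau>: "\<And>h. \<tau> h \<in> ?D" "\<And>h. cc l - d h \<le> f l (\<gamma> h (\<tau> h))" for \<tau>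
  proof (rule bounds[OF ls(1-3)], intro conjI)
    fix h
    note u = up[OF \<tau>(1)[of h], of h]
    have "(M + 1) * d h \<le> \<bar>M + 1\<bar> * d h" using d0[of h] by (intro mult_right_mono) auto
    also have "\<dots> \<le> \<bar>M + 1\<bar> * d 0" using d_le by (intro mult_left_mono) auto
    finally show "f (ls h) (\<gamma> h (\<tau> h)) \<le> C" using u by (simp add: C_def)
    show "- f l (\<gamma> h (\<tau> h)) \<le> C" using \<tau>(2)[of h] d_le[of h] by (simp add: C_def)
    have "f (ls h) (\<gamma> h (\<tau> h)) - f l (\<gamma> h (\<tau> h)) \<le> (M + 2) * d h"
      using u \<tau>(2)[of h] by (simp add: algebra_simps)
    then have "(f (ls h) (\<gamma> h (\<tau> h)) - f l (\<gamma> h (\<tau> h))) / (l - ls h) \<le> M + 2"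
      using d0[of h] by (simp add: d_def pos_divide_le_eq)
    then show "(f (ls h) (\<gamma> h (\<tau> h)) - f l (\<gamma> h (\<tau> h))) / (l - ls h) \<le> C"
      by (simp add: C_def)
  qed
  have "\<exists>t\<in>?D. \<forall>s\<in>?D. f l (\<gamma> h s) \<le> f l (\<gamma> h t)" for h
    by (rule continuous_attains_sup) (auto intro!: continuous_on_compose2[OF f_cont[OF l] \<gamma>c])
  \<comment> \<open>Selecting maximum points lets \<open>sel\<close> control the maximum of
    \<open>f l\<close> along the whole map by \<open>f (ls h)\<close> at a single point.\<close>
  then obtain \<tau> where \<tau>: "\<And>h. \<tau> h \<in> ?D" "\<And>h s. s \<in> ?D \<Longrightarrow> f l (\<gamma> h s) \<le> f l (\<gamma> h (\<tau> h))"
    by metis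
  have \<tau>c: "cc l - d h \<le> f l (\<gamma> h (\<tau> h))" for h
  proof -
    obtain t where "t \<in> ?D" "cc l \<le> f l (\<gamma> h t)" using cc_le[OF \<gamma>(1)] by blast
    then show ?thesis using \<tau>(2)[of t h] d0[of h] by linarith
  qed
  \<comment> \<open>\<open>bounds\<close> speaks of sequences, but its constant depends only on
    \<open>C\<close>. Replacing the single entry \<open>\<tau> h\<close> by \<open>t\<close>
    therefore bounds every point of the high part.\<close>
  have near: "norm (\<gamma> h t) \<le> B C" if "t \<in> ?D" "cc l - d h \<le> f l (\<gamma> h t)" for h t
  proof -
    have "(\<tau>(h := t)) k \<in> ?D" "cc l - d k \<le> f l (\<gamma> k ((\<tau>(h := t)) k))" for k
      using that \<tau>(1)[of k] \<tau>c[of k] by (auto simp only: fun_upd_apply split: if_splits)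
    from sel[OF this] have "norm (\<gamma> h ((\<tau>(h := t)) h)) \<le> B C" by blast
    then show ?thesis by simp
  qed
  obtain K where K: "K > 0" "\<And>u v. norm (emb u - emb v) \<le> K * norm (u - v)"
  proof -
    interpret bounded_linear emb by (rule emb_bounded_linear)
    obtain K where "K > 0" "\<And>x. norm (emb x) \<le> norm x * K" using pos_bounded by blast
    then show ?thesis using that[of K] by (simp add: diff[symmetric] mult.commute)
  qed
  obtain L where L: "L \<ge> 0"
    "\<And>u v. norm (emb (symm_ext symm \<Theta> u) - emb (symm_ext symm \<Theta> v)) \<le> L * norm (emb u - emb v)"
    using symm_ext_lipschitz by blast
  have ex: "\<exists>u. norm u \<le> B C + e \<and> \<bar>f l u - cc l\<bar> \<le> e\<^sup>2 \<and> weak_slope (f l) u \<le> ennreal (2 * e) \<and>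
      norm (emb u - emb (symm_ext symm \<Theta> u)) \<le> (1 + (1 + L) * K) * e" if "e > 0" for e
  proof -
    \<comment> \<open>One \<open>h\<close> is chosen so late that the level error and the comparison
      error are at most \<open>e\<^sup>2 / 2\<close> each; together they give the excess
      \<open>e\<^sup>2\<close> allowed in \<open>minimax_almost_critical_point\<close>.\<close>
    have "(\<lambda>h. \<bar>M + 1\<bar> * d h) \<longlonglongrightarrow> \<bar>M + 1\<bar> * 0" by (intro tendsto_intros d_lim)
    then have "\<forall>\<^sub>F h in sequentially. \<bar>M + 1\<bar> * d h < e\<^sup>2 / 2"
      using \<open>e > 0\<close> by (intro order_tendstoD(2)) auto
    moreover have "\<forall>\<^sub>F h in sequentially. d h < e"
      using d_lim \<open>e > 0\<close> by (rule order_tendstoD(2))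
    moreover have "\<forall>\<^sub>F h in sequentially. f l (\<gamma> h (\<tau> h)) \<le> f (ls h) (\<gamma> h (\<tau> h)) + e\<^sup>2 / 2"
      using sel[OF \<tau>(1) \<tau>c] \<open>e > 0\<close> by simp
    ultimately have "\<forall>\<^sub>F h in sequentially. \<bar>M + 1\<bar> * d h < e\<^sup>2 / 2 \<and> d h < e \<and>
        f l (\<gamma> h (\<tau> h)) \<le> f (ls h) (\<gamma> h (\<tau> h)) + e\<^sup>2 / 2"
      by eventually_elim blast
    then obtain h where h: "\<bar>M + 1\<bar> * d h < e\<^sup>2 / 2" "d h < e"
        "f l (\<gamma> h (\<tau> h)) \<le> f (ls h) (\<gamma> h (\<tau> h)) + e\<^sup>2 / 2"
      using eventually_happens by fastforce
    have "(M + 1) * d h \<le> \<bar>M + 1\<bar> * d h" using d0[of h] by (intro mult_right_mono) auto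
    then have top: "f l (\<gamma> h t) \<le> cc l + e\<^sup>2" if "t \<in> ?D" for t
      using h \<tau>(2)[OF that, of h] up[OF \<tau>(1)[of h], of h] by linarith
    have gaph: "a < cc l - d h" using gap[of h] by (simp add: d_def)
    \<comment> \<open>The boundary values are at most \<open>a\<close>, below the threshold, so a
      competitor agrees with \<open>\<gamma> h\<close> on the sphere. It is thus admissible and must
      reach \<open>cc l\<close>.\<close>
    have link: "\<exists>x\<in>?D. cc l \<le> f l (\<phi> x)"
      if \<phi>: "continuous_on ?D \<phi>" "\<And>x. x \<in> ?D \<Longrightarrow> f l (\<gamma> h x) \<le> cc l - d h \<Longrightarrow> \<phi> x = \<gamma> h x" for \<phi>
    proof -
      have b: "restrict (\<gamma> h) (sphere 0 1) \<in> \<Gamma>0"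
        using \<gamma>(1)[of h] by (simp add: admissible_maps_def)
      have "\<phi> x = \<gamma> h x" if "x \<in> sphere 0 1" for x
        using \<phi>(2)[of x] bdry[OF b that] that gaph by simp
      then have "restrict (restrict \<phi> ?D) (sphere 0 1) = restrict (\<gamma> h) (sphere 0 1)"
        by (intro restrict_ext) simp
      moreover have "continuous_on ?D (restrict \<phi> ?D)"
        using \<phi>(1) by (rule continuous_on_eq) simp
      ultimately have "restrict \<phi> ?D \<in> admissible_maps \<Gamma>0"
        using b by (simp add: admissible_maps_def cont_maps_def)
      then show ?thesis using cc_le by fastforce
    qed
    obtain u x where ux: "x \<in> ?D" "cc l - d h < f l (\<gamma> h x)" "dist (\<gamma> h x) u \<le> e"
      "cc l \<le> f l u" "f l u \<le> cc l + e\<^sup>2" "weak_slope (f l) u \<le> ennreal (2 * e)"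
      by (rule minimax_almost_critical_point[OF compact_cball convex_cball _ f_cont[OF l] \<gamma>c[of h]
            \<open>e > 0\<close> _ link top, of "cc l - d h"]) (use d0[of h] in auto)
    define v where "v = \<gamma> h x"
    have vu: "norm (v - u) \<le> e" using ux(3) by (simp add: v_def dist_norm)
    have "norm v \<le> B C" unfolding v_def by (rule near) (use ux in auto)
    then have "norm u \<le> B C + e"
      using vu norm_triangle_ineq4[of v "v - u"] by simp
    \<comment> \<open>The constant collects \<open>e\<close> for the asymmetry of \<open>v\<close>,
      \<open>K * e\<close> for the distance of \<open>u\<close> and \<open>v\<close> after
      \<open>emb\<close>, and \<open>L * K * e\<close> for that of their symmetrizations.\<close>
    moreover have "norm (emb u - emb (symm_ext symm \<Theta> u)) \<le> (1 + (1 + L) * K) * e"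
    proof -
      have "v \<in> S" unfolding v_def using \<gamma>(2)[of h] ux(1) by blast
      then have "norm (emb v - emb (symm_ext symm \<Theta> v)) \<le> e"
        using \<gamma>(4)[OF ux(1), of h] ux(2) h(2) by (simp add: v_def symm_ext_def Theta_id)
      moreover have uv: "norm (emb u - emb v) \<le> K * e"
        using K(2)[of u v] vu K(1) by (smt (verit) mult_left_mono norm_minus_commute)
      moreover have "norm (emb (symm_ext symm \<Theta> v) - emb (symm_ext symm \<Theta> u)) \<le> L * (K * e)"
        using L(2)[of v u] mult_left_mono[OF uv L(1)] by (simp add: norm_minus_commute)
      moreover have "norm (emb u - emb (symm_ext symm \<Theta> u)) \<le> norm (emb u - emb v)
          + norm (emb v - emb (symm_ext symm \<Theta> v))
          + norm (emb (symm_ext symm \<Theta> v) - emb (symm_ext symm \<Theta> u))"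
        using norm_triangle_ineq[of "emb u - emb v" "emb v - emb (symm_ext symm \<Theta> v)"]
          norm_triangle_ineq[of "emb u - emb (symm_ext symm \<Theta> v)" "emb (symm_ext symm \<Theta> v) - emb (symm_ext symm \<Theta> u)"]
        by simp
      ultimately show ?thesis by (simp add: algebra_simps)
    qed
    ultimately show ?thesis
      using ux by (intro exI[of _ u]) auto
  qed
  define e where "e n = inverse (real (Suc n))" for n
  have e: "e n > 0" "e n \<le> 1" for n by (auto simp: e_def inverse_eq_divide)
  have e_lim: "e \<longlonglongrightarrow> 0" unfolding e_def by (rule LIMSEQ_inverse_real_of_nat)
  obtain u where u: "\<And>n. norm (u n) \<le> B C + e n" "\<And>n. \<bar>f l (u n) - cc l\<bar> \<le> (e n)\<^sup>2"
      "\<And>n. weak_slope (f l) (u n) \<le> ennreal (2 * e n)"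
      "\<And>n. norm (emb (u n) - emb (symm_ext symm \<Theta> (u n))) \<le> (1 + (1 + L) * K) * e n"
    using ex[OF e(1)] by metis
  have "SBPS_sequence emb (symm_ext symm \<Theta>) (f l) (cc l) u"
    unfolding SBPS_sequence_def
  proof (intro conjI)
    have "norm (u n) \<le> B C + 1" for n using u(1)[of n] e(2)[of n] by linarith
    then show "bounded (range u)" by (auto simp: bounded_iff)
    have "(\<lambda>n. ennreal (2 * e n)) \<longlonglongrightarrow> ennreal (2 * 0)"
      by (intro tendsto_ennrealI tendsto_intros e_lim)
    then show "(\<lambda>n. weak_slope (f l) (u n)) \<longlonglongrightarrow> 0"
      by (intro tendsto_sandwich[of "\<lambda>_. 0" "\<lambda>n. weak_slope (f l) (u n)"]) (auto simp: u(3))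
    have "(\<lambda>n. (e n)\<^sup>2) \<longlonglongrightarrow> 0" using tendsto_power[OF e_lim, of 2] by simp
    then have "(\<lambda>n. f l (u n) - cc l) \<longlonglongrightarrow> 0"
      by (rule Lim_null_comparison[rotated]) (simp add: u(2))
    then show "(\<lambda>n. f l (u n)) \<longlonglongrightarrow> cc l" by (rule LIM_zero_cancel)
    have "(\<lambda>n. (1 + (1 + L) * K) * e n) \<longlonglongrightarrow> 0"
      by (intro tendsto_mult_right_zero e_lim)
    then show "(\<lambda>n. norm (emb (u n) - emb (symm_ext symm \<Theta> (u n)))) \<longlonglongrightarrow> 0"
      by (rule Lim_null_comparison[rotated]) (simp only: real_norm_def abs_norm_cancel u(4) eventually_True)
  qed
  then show ?thesis by blast
qed

section \<open>Finite levels and the almost-everywhere statement\<close>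

text \<open>The strict gap excludes the value minus infinity and compactness of the ball excludes
  plus infinity, so \<open>real_of_ereal\<close> loses nothing. Suprema over the ball are attained,
  which gives a point at level \<open>c\<close> without an error term; a real number between the two
  levels replaces the boundary level.\<close>

lemma minimax_level_real:
  fixes f :: "real \<Rightarrow> 'a::topological_space \<Rightarrow> real" and \<Gamma>0 :: "(real ^ 'm \<Rightarrow> 'a) set"
  assumes cont: "continuous_on UNIV (f k)" and ne: "admissible_maps \<Gamma>0 \<noteq> {}"
    and gap: "boundary_level f \<Gamma>0 k < minimax_level f \<Gamma>0 k"
  defines "c \<equiv> real_of_ereal (minimax_level f \<Gamma>0 k)"
  shows "\<And>\<gamma>. \<gamma> \<in> admissible_maps \<Gamma>0 \<Longrightarrow> \<exists>t\<in>cball 0 1. c \<le> f k (\<gamma> t)"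
    and "\<And>e. e > 0 \<Longrightarrow> \<exists>\<gamma>\<in>admissible_maps \<Gamma>0. \<forall>t\<in>cball 0 1. f k (\<gamma> t) \<le> c + e"
    and "\<exists>a<c. \<forall>\<gamma>\<in>\<Gamma>0. \<forall>\<tau>\<in>sphere 0 1. f k (\<gamma> \<tau>) \<le> a"
proof -
  let ?m = "minimax_level f \<Gamma>0 k"
  have att: "\<exists>t\<in>cball 0 1. ?m \<le> ereal (f k (\<gamma> t))" if \<gamma>: "\<gamma> \<in> admissible_maps \<Gamma>0" for \<gamma>
  proof -
    have "continuous_on (cball 0 1) \<gamma>" using \<gamma> by (simp add: admissible_maps_def cont_maps_def)
    then have "continuous_on (cball 0 1) (\<lambda>t. f k (\<gamma> t))"
      by (rule continuous_on_compose2[OF cont]) auto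
    then obtain t where t: "t \<in> cball 0 1" "\<And>s. s \<in> cball 0 1 \<Longrightarrow> f k (\<gamma> s) \<le> f k (\<gamma> t)"
      using continuous_attains_sup[of "cball 0 1" "\<lambda>t. f k (\<gamma> t)"] by auto
    have "?m \<le> (SUP s\<in>cball 0 1. ereal (f k (\<gamma> s)))"
      unfolding minimax_level_def using \<gamma> by (rule INF_lower)
    also have "\<dots> \<le> ereal (f k (\<gamma> t))" using t by (intro SUP_least) simp
    finally show ?thesis using t(1) by blast
  qed
  have bd: "ereal (f k (\<gamma> \<tau>)) \<le> boundary_level f \<Gamma>0 k" if "\<gamma> \<in> \<Gamma>0" "\<tau> \<in> sphere 0 1" for \<gamma> \<tau>
    unfolding boundary_level_def using that by (intro SUP_upper2[of \<gamma>] SUP_upper2[of \<tau>]) auto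
  obtain \<gamma> where \<gamma>: "\<gamma> \<in> admissible_maps \<Gamma>0" using ne by blast
  have "?m < \<infinity>" using att[OF \<gamma>] by auto
  moreover have "- \<infinity> < ?m" using gap by (auto intro: le_less_trans)
  ultimately have c: "?m = ereal c"
    unfolding c_def by (cases ?m) auto
  show "\<exists>t\<in>cball 0 1. c \<le> f k (\<gamma> t)" if "\<gamma> \<in> admissible_maps \<Gamma>0" for \<gamma>
    using att[OF that] by (simp add: c)
  show "\<exists>\<gamma>\<in>admissible_maps \<Gamma>0. \<forall>t\<in>cball 0 1. f k (\<gamma> t) \<le> c + e" if "e > 0" for e
  proof -
    have "?m < ereal (c + e)" using that by (simp add: c)
    then obtain \<gamma> where \<gamma>: "\<gamma> \<in> admissible_maps \<Gamma>0" "(SUP t\<in>cball 0 1. ereal (f k (\<gamma> t))) < ereal (c + e)"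
      unfolding minimax_level_def INF_less_iff by blast
    have "f k (\<gamma> t) \<le> c + e" if "t \<in> cball 0 1" for t
    proof -
      have "ereal (f k (\<gamma> t)) \<le> (SUP t\<in>cball 0 1. ereal (f k (\<gamma> t)))" using that by (rule SUP_upper)
      then have "ereal (f k (\<gamma> t)) < ereal (c + e)" using \<gamma>(2) by (rule le_less_trans)
      then show ?thesis by simp
    qed
    then show ?thesis using \<gamma>(1) by blast
  qed
  obtain a where a: "boundary_level f \<Gamma>0 k < ereal a" "ereal a < ?m" using gap ereal_dense2 by blast
  have "f k (\<gamma> \<tau>) \<le> a" if "\<gamma> \<in> \<Gamma>0" "\<tau> \<in> sphere 0 1" for \<gamma> \<tau>
    using le_less_trans[OF bd[OF that] a(1)] by simp
  moreover have "a < c" using a(2) by (simp add: c)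
  ultimately show "\<exists>a<c. \<forall>\<gamma>\<in>\<Gamma>0. \<forall>\<tau>\<in>sphere 0 1. f k (\<gamma> \<tau>) \<le> a" by blast
qed

theorem theorem3p1:
  fixes emb :: "'a::banach \<Rightarrow> 'b::banach"
    and S :: "'a set"
    and Hs :: "'h::topological_space set"
    and symm \<Theta> :: "'a \<Rightarrow> 'a"
    and pol :: "'a \<Rightarrow> 'h \<Rightarrow> 'a"
    and \<Lambda> :: "real set"
    and f :: "real \<Rightarrow> 'a \<Rightarrow> real"
    and \<Gamma>0 :: "(real ^ 'm \<Rightarrow> 'a) set"
  assumes framework: "symmetrization_framework emb S Hs symm pol \<Theta>"
    and Lambda: "compact \<Lambda>" "is_interval \<Lambda>"
    and f_cont: "\<And>l. l \<in> \<Lambda> \<Longrightarrow> continuous_on UNIV (f l)"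
    and Gamma0: "\<Gamma>0 \<subseteq> cont_maps (sphere 0 1)"
    and Gamma_ne: "admissible_maps \<Gamma>0 \<noteq> {}"
    and level_gap: "\<And>l. l \<in> \<Lambda> \<Longrightarrow> minimax_level f \<Gamma>0 l > boundary_level f \<Gamma>0 l"
    and bounds: "\<exists>M :: real \<Rightarrow> real. \<forall>C. 0 \<le> M C \<and>
      (\<forall>(ls :: nat \<Rightarrow> real) (u :: nat \<Rightarrow> 'a) l.
         range ls \<subseteq> \<Lambda> \<longrightarrow> strict_mono ls \<longrightarrow> ls \<longlonglongrightarrow> l \<longrightarrow>
         (\<forall>h. f (ls h) (u h) \<le> C \<and> - f l (u h) \<le> C \<and>
              (f (ls h) (u h) - f l (u h)) / (l - ls h) \<le> C) \<longrightarrow>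
         (\<forall>h. norm (u h) \<le> M C) \<and>
         (\<forall>\<epsilon>>0. \<forall>\<^sub>F h in sequentially. f l (u h) \<le> f (ls h) (u h) + \<epsilon>))"
    and symmetrize: "\<And>\<gamma>. \<gamma> \<in> admissible_maps \<Gamma>0 \<Longrightarrow>
      \<exists>\<gamma>'\<in>admissible_maps \<Gamma>0. \<exists>H0\<in>Hs.
        \<gamma>' ` cball 0 1 \<subseteq> S \<and>
        restrict (\<lambda>\<tau>. pol (\<gamma>' \<tau>) H0) (sphere 0 1) \<in> \<Gamma>0 \<and>
        (\<forall>t\<in>cball 0 1. \<forall>l\<in>\<Lambda>. f l (\<gamma>' t) \<le> f l (\<gamma> t))"
    and pol_decreases: "\<And>l H u. l \<in> \<Lambda> \<Longrightarrow> H \<in> Hs \<Longrightarrow> u \<in> S \<Longrightarrow> f l (pol u H) \<le> f l u"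
  shows "AE l\<in>\<Lambda> in lebesgue.
    \<exists>u. SBPS_sequence emb (symm_ext symm \<Theta>) (f l) (real_of_ereal (minimax_level f \<Gamma>0 l)) u"
proof -
  interpret symmetrization_framework emb S Hs symm pol \<Theta> by (rule framework)
  define cc where "cc l = real_of_ereal (minimax_level f \<Gamma>0 l)" for l
  \<comment> \<open>The left endpoint is discarded because no parameter of \<Lambda> lies to its
    left. The null-set lemma holds for any real function, so the values of \<open>cc\<close> off
    \<Lambda> do no harm.\<close>
  define N where "N = {x. filterlim (\<lambda>y. (cc y - cc x) / (x - y)) at_top (at_left x)} \<union> {Inf \<Lambda>}"
  obtain B :: "real \<Rightarrow> real" where bounds': "\<And>C ls (u :: nat \<Rightarrow> 'a) l.
      range ls \<subseteq> \<Lambda> \<Longrightarrow> strict_mono ls \<Longrightarrow> ls \<longlonglongrightarrow> l \<Longrightarrow>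
      (\<And>h. f (ls h) (u h) \<le> C \<and> - f l (u h) \<le> C \<and> (f (ls h) (u h) - f l (u h)) / (l - ls h) \<le> C) \<Longrightarrow>
      (\<forall>h. norm (u h) \<le> B C) \<and> (\<forall>\<epsilon>>0. \<forall>\<^sub>F h in sequentially. f l (u h) \<le> f (ls h) (u h) + \<epsilon>)"
    using bounds by (elim exE) blast
  have ex: "\<exists>u. SBPS_sequence emb (symm_ext symm \<Theta>) (f l) (cc l) u" if l: "l \<in> \<Lambda>" "l \<notin> N" for l
  proof -
    have lb: "Inf \<Lambda> \<in> \<Lambda>" "Inf \<Lambda> < l"
    proof -
      have "closed \<Lambda>" "bdd_below \<Lambda>"
        using Lambda(1) by (auto intro: compact_imp_closed bounded_imp_bdd_below compact_imp_bounded)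
      then show "Inf \<Lambda> \<in> \<Lambda>" using l(1) by (intro closed_contains_Inf) auto
      show "Inf \<Lambda> < l" using cInf_lower[OF l(1) \<open>bdd_below \<Lambda>\<close>] l(2) by (auto simp: N_def less_le)
    qed
    obtain a where a: "a < cc l" "\<And>\<gamma> \<tau>. \<gamma> \<in> \<Gamma>0 \<Longrightarrow> \<tau> \<in> sphere 0 1 \<Longrightarrow> f l (\<gamma> \<tau>) \<le> a"
      using minimax_level_real(3)[OF f_cont[OF l(1)] Gamma_ne level_gap[OF l(1)]]
      unfolding cc_def by blast
    have "\<not> filterlim (\<lambda>y. (cc y - cc l) / (l - y)) at_top (at_left l)"
      using l(2) by (simp add: N_def)
    \<comment> \<open>The first bound keeps the sequence in \<Lambda>; the second rearranges to
      \<open>a < cc l - (l - ls n)\<close>, the gap needed above the boundary values.\<close>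
    moreover have "max (Inf \<Lambda>) (l - (cc l - a)) < l" using lb a(1) by simp
    ultimately obtain M ls where ls: "strict_mono ls" "ls \<longlonglongrightarrow> l"
      "\<And>n. max (Inf \<Lambda>) (l - (cc l - a)) < ls n" "\<And>n::nat. ls n < l"
      "\<And>n. cc (ls n) - cc l \<le> M * (l - ls n)"
      by (rule left_quotient_bounded_sequence) blast
    have "range ls \<subseteq> \<Lambda>"
    proof
      fix x assume "x \<in> range ls"
      then have "Inf \<Lambda> \<le> x" "x \<le> l" using ls(3,4) by (auto intro: less_imp_le)
      then show "x \<in> \<Lambda>" using Lambda(2) lb(1) l(1) unfolding is_interval_1 by blast
    qed
    have le: "\<exists>t\<in>cball 0 1. cc l \<le> f l (\<gamma> t)" if "\<gamma> \<in> admissible_maps \<Gamma>0" for \<gamma>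
      unfolding cc_def
      by (rule minimax_level_real(1)[OF f_cont[OF l(1)] Gamma_ne level_gap[OF l(1)] that])
    have approx: "\<exists>\<gamma>\<in>admissible_maps \<Gamma>0. \<forall>t\<in>cball 0 1. f k (\<gamma> t) \<le> cc k + e"
      if "k \<in> \<Lambda>" "e > 0" for k e
      unfolding cc_def
      by (rule minimax_level_real(2)[OF f_cont[OF that(1)] Gamma_ne level_gap[OF that(1)] that(2)])
    have gap: "a < cc l - (l - ls h)" for h using ls(3)[of h] by simp
    show ?thesis
      by (rule SBPS_sequence_at_parameter[where f = f and ?\<Gamma>0.0 = \<Gamma>0 and cc = cc and \<Lambda> = \<Lambda>
            and B = B and l = l and a = a and ls = ls and M = M])
        (fact f_cont bounds' symmetrize pol_decreases le approx a(2) l(1)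
            \<open>range ls \<subseteq> \<Lambda>\<close> ls(1,2,4) gap ls(5))+
  qed
  have "N \<in> null_sets lebesgue"
    unfolding N_def negligible_iff_null_sets[symmetric]
    by (intro negligible_Un negligible_left_derivative_infinite) simp
  then show ?thesis
    using ex unfolding cc_def by (intro AE_I'[of N]) auto
qed

end
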